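(* For every $\varepsilon>0$ there exists $T$ such that for all integers $t\ge T$ and $k\ge 1$ with $k\ge T\log t$, we have $\mathbb P\big(X(k,t,1)\le \varepsilon kt\big)\ge 1-\varepsilon$. In other words, as $t$ and $k/\log t$ tend to infinity, $X(k,t,1)=o(kt)$ with high probability.
   Context: For positive integers $k,t,m$, a random necklace is an open necklace (a linear sequence) of $ktm$ beads, containing exactly $km$ beads of each of $t$ types, chosen uniformly at random among all such sequences. A set of cuts (positions between consecutive beads) is called fair if the resulting intervals can be split into $k$ collections each containing exactly $m$ beads of each type. $X(k,t,m)$ denotes the minimum number of cuts in a fair set of cuts of the random necklace. Here $m=1$: there are $k$ beads of each type and each collection must contain exactly one bead of each type. *)

theory Defs
  imports "HOL-Probability.Probability"
begin

text \<open>
  A necklace is a list of beads; the bead types are the numbers below \<open>t\<close>.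
\<close>

definition necklaces :: "nat \<Rightarrow> nat \<Rightarrow> nat \<Rightarrow> nat list set" where
  "necklaces k t m =
     {xs. length xs = k * t * m \<and> set xs \<subseteq> {..<t} \<and> (\<forall>i<t. count_list xs i = k * m)}"

text \<open>
  The beads occupy positions \<open>0, \<dots>, n - 1\<close>. A cut \<open>c\<close> with \<open>0 < c < n\<close> lies between the
  beads at positions \<open>c - 1\<close> and \<open>c\<close>. An interval is represented by its set of positions.
\<close>

definition cut_intervals :: "nat \<Rightarrow> nat set \<Rightarrow> nat set set" where
  "cut_intervals n C =
     {{a..<b} | a b. a \<in> insert 0 C \<and> b \<in> insert n C \<and> a < b \<and> {a<..<b} \<inter> C = {}}"

text \<open>The interval \<open>I\<close> is put into the collection with number \<open>g I\<close>.\<close>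

definition fair_cuts :: "nat \<Rightarrow> nat \<Rightarrow> nat \<Rightarrow> nat list \<Rightarrow> nat set \<Rightarrow> bool" where
  "fair_cuts k t m xs C \<longleftrightarrow>
     C \<subseteq> {0<..<length xs} \<and>
     (\<exists>g \<in> cut_intervals (length xs) C \<rightarrow> {..<k}.
        \<forall>j<k. \<forall>i<t.
          card {p \<in> \<Union>{I \<in> cut_intervals (length xs) C. g I = j}. xs ! p = i} = m)"

definition min_fair_cuts :: "nat \<Rightarrow> nat \<Rightarrow> nat \<Rightarrow> nat list \<Rightarrow> nat" where
  "min_fair_cuts k t m xs = (LEAST r. \<exists>C. fair_cuts k t m xs C \<and> card C = r)"

definition random_necklace :: "nat \<Rightarrow> nat \<Rightarrow> nat \<Rightarrow> nat list pmf" where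
  "random_necklace k t m = pmf_of_set (necklaces k t m)"

text \<open>
  The set of necklaces is finite and nonempty, and every necklace has a fair set of cuts, so
  neither \<^const>\<open>pmf_of_set\<close> nor \<^const>\<open>Least\<close> is used outside its intended domain.
\<close>

lemma finite_necklaces: "finite (necklaces k t m)"
proof (rule finite_subset)
  show "necklaces k t m \<subseteq> {xs. set xs \<subseteq> {..<t} \<and> length xs = k * t * m}"
    by (auto simp: necklaces_def)
qed (rule finite_lists_length_eq, simp)

lemma necklaces_nonempty: "necklaces k t m \<noteq> {}"
proof -
  define f where "f s = concat (map (replicate (k * m)) [0..<s])" for s
  have "length (f s) = k * s * m \<and> set (f s) \<subseteq> {..<s} \<and>
        (\<forall>i. count_list (f s) i = (if i < s then k * m else 0))" for s
  proof (induction s)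
    case 0
    then show ?case by (simp add: f_def)
  next
    case (Suc s)
    have rep: "count_list (replicate N a) b = (if a = b then N else 0)" for N and a b :: nat
      by (induction N) auto
    have "f (Suc s) = f s @ replicate (k * m) s" by (simp add: f_def)
    with Suc show ?case by (auto simp: algebra_simps rep)
  qed
  then have "f t \<in> necklaces k t m" by (simp add: necklaces_def)
  then show ?thesis by blast
qed

lemma set_random_necklace: "set_pmf (random_necklace k t m) = necklaces k t m"
  by (simp add: random_necklace_def finite_necklaces necklaces_nonempty)

lemma fair_cuts_exist:
  assumes "xs \<in> necklaces k t m"
  shows "\<exists>C. fair_cuts k t m xs C"
proof -
  define n where "n = length xs"
  define P where "P i = {p. p < n \<and> xs ! p = i}" for i
  have cardP: "card (P i) = k * m" if "i < t" for i
  proof -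
    have "k * m = card {p. p < length xs \<and> i = xs ! p}"
      using assms that
      by (auto simp: necklaces_def count_list_eq_length_filter length_filter_conv_card)
    also have "{p. p < length xs \<and> i = xs ! p} = P i" by (auto simp: P_def n_def)
    finally show ?thesis by simp
  qed
  have "\<exists>b. bij_betw b (P i) {..<k * m}" if "i < t" for i
    using cardP[OF that] by (intro finite_same_card_bij) (auto simp: P_def)
  then obtain b where b: "\<And>i. i < t \<Longrightarrow> bij_betw (b i) (P i) {..<k * m}" by metis
  define h where "h p = b (xs ! p) p div m" for p
  define C where "C = {0<..<n}"
  have xt: "xs ! p < t" if "p < n" for p
    using assms nth_mem[of p xs] that by (auto simp: necklaces_def n_def simp del: nth_mem)
  have ints: "cut_intervals n C = (\<lambda>p. {p}) ` {..<n}"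
  proof safe
    fix I assume "I \<in> cut_intervals n C"
    then obtain a c where I: "I = {a..<c}" "a \<in> insert 0 C" "c \<in> insert n C" "a < c"
      "{a<..<c} \<inter> C = {}" by (auto simp: cut_intervals_def)
    have "c \<le> n" using I by (auto simp: C_def)
    have "c = Suc a"
    proof (rule ccontr)
      assume "c \<noteq> Suc a"
      then have "Suc a \<in> {a<..<c} \<inter> C" using I(4) \<open>c \<le> n\<close> by (auto simp: C_def)
      then show False using I(5) by blast
    qed
    then show "I \<in> (\<lambda>p. {p}) ` {..<n}" using I \<open>c \<le> n\<close> by auto
  next
    fix p assume "p < n"
    then have "{p} = {p..<Suc p} \<and> p \<in> insert 0 C \<and> Suc p \<in> insert n C \<and> p < Suc p \<and>
      {p<..<Suc p} \<inter> C = {}" by (auto simp: C_def)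
    then show "{p} \<in> cut_intervals n C"
      unfolding cut_intervals_def by (intro CollectI exI[of _ p] exI[of _ "Suc p"])
  qed
  define g where "g I = h (the_elem I)" for I
  have hk: "h p < k" if "p < n" for p
  proof -
    have "p \<in> P (xs ! p)" using that by (simp add: P_def)
    then have "b (xs ! p) p < k * m" using b[OF xt[OF that]] by (auto simp: bij_betw_def)
    then show ?thesis by (simp add: h_def less_mult_imp_div_less)
  qed
  have "card {p \<in> \<Union>{I \<in> cut_intervals n C. g I = j}. xs ! p = i} = m"
    if "j < k" "i < t" for i j
  proof (cases "m = 0")
    case True
    then have "n = 0" using assms by (simp add: necklaces_def n_def)
    then have "cut_intervals n C = {}" unfolding ints by simp
    then show ?thesis using True by simp
  next
    case False
    have c1: "{p \<in> \<Union>{I \<in> cut_intervals n C. g I = j}. xs ! p = i} = {p \<in> P i. b i p div m = j}"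
      by (auto simp: ints g_def h_def P_def)
    have bij: "bij_betw (b i) {p \<in> P i. b i p div m = j} {q \<in> {..<k * m}. q div m = j}"
      using b[OF that(2)] by (auto simp: bij_betw_def inj_on_def image_iff)
    have c2: "card {p \<in> P i. b i p div m = j} = card {q \<in> {..<k * m}. q div m = j}"
      using bij by (rule bij_betw_same_card)
    have c3: "{q \<in> {..<k * m}. q div m = j} = {j * m..<j * m + m}"
    proof -
      have iff: "q div m = j \<longleftrightarrow> j * m \<le> q \<and> q < j * m + m" for q
      proof
        assume "q div m = j"
        then show "j * m \<le> q \<and> q < j * m + m"
          using False dividend_less_div_times[of m q] by auto
      next
        assume "j * m \<le> q \<and> q < j * m + m"
        then show "q div m = j" by (intro div_nat_eqI) (auto simp: algebra_simps)
      qed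
      have le: "j * m + m \<le> k * m"
        using that(1) by (metis Suc_leI add.commute mult_Suc mult_le_mono1)
      show ?thesis
      proof (intro set_eqI iffI)
        fix q assume "q \<in> {q \<in> {..<k * m}. q div m = j}"
        then show "q \<in> {j * m..<j * m + m}" using iff[of q] by simp
      next
        fix q assume "q \<in> {j * m..<j * m + m}"
        then have "j * m \<le> q \<and> q < j * m + m" by simp
        moreover from this le have "q < k * m" by linarith
        ultimately show "q \<in> {q \<in> {..<k * m}. q div m = j}" using iff[of q] by blast
      qed
    qed
    show ?thesis unfolding c1 c2 c3 by simp
  qed
  then have "fair_cuts k t m xs C"
    unfolding fair_cuts_def n_def[symmetric]
    by (intro conjI bexI[of _ g]) (auto simp: C_def[symmetric] ints g_def hk)
  then show ?thesis by blast
qed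

lemma min_fair_cuts_attained:
  assumes "xs \<in> necklaces k t m"
  shows "\<exists>C. fair_cuts k t m xs C \<and> card C = min_fair_cuts k t m xs"
  unfolding min_fair_cuts_def
  by (rule LeastI_ex) (use fair_cuts_exist[OF assms] in blast)

end

(*
  Cut the necklace into intervals of constant length L and try to give each interval as a whole to
  one thief; a bead in an interval that nobody can take is cut out and given away individually.
  It suffices to show that the expected number of such failures is a small fraction.

  The thieves are split into groups of constant size B, each responsible for a stretch of B * t beads,
  so that only t tends to infinity. The beads may be taken independent and uniform, since
  a uniform word becomes a necklace after changing about t * sqrt k beads. A group gives each interval
  to a uniformly random thief among those that still miss all its types. The fraction of types that two
  given thieves both miss is a Lipschitz statistic of this Markov chain, and the Lipschitz constant
  grows only by a factor 1 + L^2 / t per step of the conditional expectation, i.e. by a bounded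
  factor in total; hence the statistic has variance O(1 / t). By the symmetry between the thieves
  its mean does not depend on the pair, and the sum over all pairs is the average of the squared number
  of thieves that miss a type, which is concentrated as well. So the pair statistic is close to the
  square of the fraction missed by one thief, and Chebyshev's inequality shows that for most intervals
  some thief misses all L types, until only a small fraction of each stretch is left.
*)

theory Submission
  imports Defs
begin


section \<open>Averages over finite sets and over words\<close>

definition mean :: "'a set \<Rightarrow> ('a \<Rightarrow> real) \<Rightarrow> real" where
  "mean A f = (\<Sum>a\<in>A. f a) / real (card A)"

lemma mean_mono: "(\<And>a. a \<in> A \<Longrightarrow> f a \<le> g a) \<Longrightarrow> mean A f \<le> mean A g"
  unfolding mean_def by (intro divide_right_mono sum_mono) auto

lemma mean_cong: "(\<And>a. a \<in> A \<Longrightarrow> f a = g a) \<Longrightarrow> mean A f = mean A g"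
  unfolding mean_def by (simp cong: sum.cong)

lemma mean_const: "finite A \<Longrightarrow> A \<noteq> {} \<Longrightarrow> mean A (\<lambda>_. c) = c"
  unfolding mean_def by simp

lemma mean_lessThan_const: "t > 0 \<Longrightarrow> mean {..<t::nat} (\<lambda>_. c) = c"
  by (intro mean_const) (auto simp: lessThan_empty_iff)

lemma mean_add: "mean A (\<lambda>a. f a + g a) = mean A f + mean A g"
  unfolding mean_def by (simp add: sum.distrib add_divide_distrib)

lemma mean_diff: "mean A (\<lambda>a. f a - g a) = mean A f - mean A g"
  unfolding mean_def by (simp add: sum_subtractf diff_divide_distrib)

lemma mean_cmult: "mean A (\<lambda>a. c * f a) = c * mean A f"
  unfolding mean_def by (simp add: sum_distrib_left)

lemma mean_sum: "mean A (\<lambda>a. \<Sum>j\<in>J. f j a) = (\<Sum>j\<in>J. mean A (f j))"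
  unfolding mean_def by (simp add: sum_divide_distrib sum.swap[of _ A])

lemma mean_abs_le: "\<bar>mean A f\<bar> \<le> mean A (\<lambda>a. \<bar>f a\<bar>)"
  unfolding mean_def by (simp add: divide_right_mono)

lemma mean_bij: "bij_betw h A B \<Longrightarrow> mean B f = mean A (\<lambda>a. f (h a))"
  unfolding mean_def by (simp add: sum.reindex_bij_betw bij_betw_same_card)

lemma mean_Times: "mean (A \<times> B) f = mean A (\<lambda>a. mean B (\<lambda>b. f (a, b)))"
proof -
  have "(\<Sum>p\<in>A \<times> B. f p) = (\<Sum>a\<in>A. \<Sum>b\<in>B. f (a, b))"
    by (simp add: sum.cartesian_product)
  then show ?thesis
    unfolding mean_def by (simp add: card_cartesian_product sum_divide_distrib[symmetric] mult.commute)
qed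

lemma mean_swap: "mean A (\<lambda>a. mean B (\<lambda>b. f a b)) = mean B (\<lambda>b. mean A (\<lambda>a. f a b))"
  unfolding mean_def
  by (simp add: sum_divide_distrib sum.swap[of _ A] mult.commute)

text \<open>The mean square deviation from \<open>c\<close> is the variance plus the squared
  distance of the mean from \<open>c\<close>, and no number \<open>y\<close> gives a smaller mean
  square deviation than the mean.\<close>

lemma variance_le_mean_square:
  assumes "finite A" "A \<noteq> {}"
  shows "mean A (\<lambda>a. (f a - c)\<^sup>2) \<le> mean A (\<lambda>a. (f a - y)\<^sup>2) + (mean A f - c)\<^sup>2"
proof -
  have *: "mean A (\<lambda>a. (f a - z)\<^sup>2) = mean A (\<lambda>a. (f a)\<^sup>2) - 2 * z * mean A f + z\<^sup>2" for z
    using assms by (simp add: power2_diff mean_add mean_diff mean_cmult mean_const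
        mult.assoc mult.commute[of "f _"])
  have "0 \<le> (mean A f - y)\<^sup>2" by simp
  then show ?thesis unfolding * by (simp add: power2_diff algebra_simps)
qed

text \<open>Pointwise replacement for Cauchy-Schwarz: averaging it turns a bound
  \<open>r\<^sup>2\<close> on the second moment into a bound \<open>r\<close> on the first absolute
  moment.\<close>

lemma abs_le_am_gm:
  fixes z r :: real
  assumes "r > 0"
  shows "\<bar>z\<bar> \<le> 1 / (2 * r) * z\<^sup>2 + r / 2"
proof -
  have "0 \<le> (\<bar>z\<bar> - r)\<^sup>2" by simp
  then have "2 * r * \<bar>z\<bar> \<le> z\<^sup>2 + r\<^sup>2" by (simp add: power2_diff algebra_simps)
  then show ?thesis using assms by (simp add: field_simps power2_eq_square)
qed

section \<open>Uniform random words\<close>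

definition words :: "nat \<Rightarrow> nat \<Rightarrow> nat list set" where
  "words t n = {w. length w = n \<and> set w \<subseteq> {..<t}}"

lemma finite_words [simp]: "finite (words t n)"
  using finite_lists_length_eq[of "{..<t}" n] by (simp add: words_def conj_commute)

lemma words_nonempty [simp]: "t > 0 \<Longrightarrow> words t n \<noteq> {}"
  by (auto simp: words_def intro!: exI[of _ "replicate n 0"])

lemma words_0: "words t 0 = {[]}"
  by (auto simp: words_def)

lemma mean_words_append:
  "mean (words t (n + m)) f = mean (words t n) (\<lambda>u. mean (words t m) (\<lambda>v. f (u @ v)))"
proof -
  have "bij_betw (\<lambda>(u, v). u @ v) (words t n \<times> words t m) (words t (n + m))"
    by (rule bij_betw_byWitness[where f' = "\<lambda>w. (take n w, drop n w)"])
      (auto simp: words_def dest: in_set_takeD in_set_dropD)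
  from mean_bij[OF this] show ?thesis by (simp add: mean_Times)
qed

lemma mean_words_Suc:
  "mean (words t (Suc n)) f = mean {..<t} (\<lambda>a. mean (words t n) (\<lambda>w. f (a # w)))"
proof -
  have "bij_betw (\<lambda>(a, w). a # w) ({..<t} \<times> words t n) (words t (Suc n))"
    by (rule bij_betw_byWitness[where f' = "\<lambda>w. (hd w, tl w)"])
      (auto simp: words_def length_Suc_conv)
  from mean_bij[OF this] show ?thesis by (simp add: mean_Times)
qed

text \<open>Independence of the letters of a uniform word.\<close>

lemma mean_words_prod_list:
  "mean (words t n) (\<lambda>w. prod_list (map \<phi> w)) = mean {..<t} \<phi> ^ n"
proof (induction n)
  case 0
  then show ?case by (simp add: words_0 mean_def)
next
  case (Suc n)
  then show ?case
    by (simp add: mean_words_Suc mean_cmult) (simp add: mult.commute[of _ "_ ^ n"] mean_cmult)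
qed

text \<open>The count is binomial with mean \<open>n / t\<close> and variance at most
  \<open>n / t\<close>. The centre \<open>a\<close> is arbitrary because the induction absorbs the
  first letter by shifting it.\<close>

lemma mean_count_list_square:
  assumes "t > 0" "i < t"
  shows "mean (words t n) (\<lambda>w. (real (count_list w i) - a)\<^sup>2) \<le> real n / real t + (real n / real t - a)\<^sup>2"
proof (induction n arbitrary: a)
  case 0
  then show ?case by (simp add: words_0 mean_def)
next
  case (Suc n)
  have "mean (words t (Suc n)) (\<lambda>w. (real (count_list w i) - a)\<^sup>2) =
      mean {..<t} (\<lambda>b. mean (words t n) (\<lambda>w. (real (count_list w i) - (a - of_bool (b = i)))\<^sup>2))"
    unfolding mean_words_Suc by (intro mean_cong) (auto simp: algebra_simps)
  also have "\<dots> \<le> mean {..<t} (\<lambda>b. real n / real t + (real n / real t - (a - of_bool (b = i)))\<^sup>2)"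
    by (intro mean_mono Suc)
  also have "\<dots> = mean {..<t} (\<lambda>b. real n / real t + (real n / real t - a)\<^sup>2
        + (2 * (real n / real t - a) + 1) * of_bool (b = i))"
    by (intro mean_cong) (auto simp: power2_eq_square algebra_simps)
  also have "\<dots> = real n / real t + (real n / real t - a)\<^sup>2 + (2 * (real n / real t - a) + 1) * (1 / real t)"
  proof -
    have "mean {..<t} (\<lambda>b. of_bool (b = i)) = 1 / real t"
      using assms by (simp add: mean_def of_bool_def)
    then show ?thesis using assms by (simp add: mean_add mean_lessThan_const mean_cmult)
  qed
  also have "\<dots> \<le> real (Suc n) / real t + (real (Suc n) / real t - a)\<^sup>2"
  proof -
    have "real (Suc n) / real t + (real (Suc n) / real t - a)\<^sup>2 =
      real n / real t + 1 / real t + (real n / real t - a)\<^sup>2 + 2 * (real n / real t - a) * (1 / real t) + (1 / real t)\<^sup>2"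
      unfolding of_nat_Suc add_divide_distrib by (simp add: power2_eq_square algebra_simps)
    moreover have "(1 / real t)\<^sup>2 \<ge> 0" by simp
    ultimately show ?thesis by (simp add: algebra_simps)
  qed
  finally show ?case .
qed

text \<open>Union bound over the positions.\<close>

lemma mean_words_meets:
  assumes "t > 0" "D \<subseteq> {..<t}"
  shows "mean (words t n) (\<lambda>w. of_bool (set w \<inter> D \<noteq> {})) \<le> real n * real (card D) / real t"
proof (induction n)
  case 0
  then show ?case by (simp add: words_0 mean_def)
next
  case (Suc n)
  have *: "mean {..<t} (\<lambda>b. of_bool (b \<in> D)) = real (card D) / real t"
    using assms by (simp add: mean_def of_bool_def sum.If_cases Int_absorb1)
  have "mean (words t (Suc n)) (\<lambda>w. of_bool (set w \<inter> D \<noteq> {})) \<le>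
      mean {..<t} (\<lambda>b. mean (words t n) (\<lambda>w. of_bool (b \<in> D) + of_bool (set w \<inter> D \<noteq> {})))"
    unfolding mean_words_Suc by (intro mean_mono) (auto simp: of_bool_def)
  also have "\<dots> = real (card D) / real t + mean (words t n) (\<lambda>w. of_bool (set w \<inter> D \<noteq> {}))"
    using assms * by (simp add: mean_add mean_const mean_lessThan_const)
  also have "\<dots> \<le> real (Suc n) * real (card D) / real t"
    using Suc by (simp add: distrib_right add_divide_distrib)
  finally show ?case .
qed

text \<open>Birthday bound: the first letter recurs later with probability at most
  \<open>n / t\<close>.\<close>

lemma mean_words_not_distinct:
  assumes "t > 0"
  shows "mean (words t n) (\<lambda>w. of_bool (\<not> distinct w)) \<le> (real n)\<^sup>2 / real t"
proof (induction n)
  case 0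
  then show ?case by (simp add: words_0 mean_def)
next
  case (Suc n)
  have *: "mean (words t n) (\<lambda>w. of_bool (b \<in> set w)) \<le> real n / real t" if "b < t" for b
    using mean_words_meets[OF assms, of "{b}" n] that by simp
  have "mean (words t (Suc n)) (\<lambda>w. of_bool (\<not> distinct w)) \<le>
      mean {..<t} (\<lambda>b. mean (words t n) (\<lambda>w. of_bool (b \<in> set w) + of_bool (\<not> distinct w)))"
    unfolding mean_words_Suc by (intro mean_mono) (auto simp: of_bool_def)
  also have "\<dots> \<le> mean {..<t} (\<lambda>b. real n / real t + (real n)\<^sup>2 / real t)"
    using * Suc by (intro mean_mono) (simp add: mean_add add_mono)
  also have "\<dots> = (real n + (real n)\<^sup>2) / real t"
    using assms by (simp add: mean_lessThan_const add_divide_distrib)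
  also have "\<dots> \<le> (real (Suc n))\<^sup>2 / real t"
    by (intro divide_right_mono) (auto simp: power2_eq_square algebra_simps)
  finally show ?case .
qed


section \<open>Partial distributions of the beads\<close>

text \<open>
  A partial distribution \<open>h\<close> maps the bead positions to thieves, \<open>None\<close> meaning that the bead is cut
  out and given away at the very end. \<open>x i\<close> is the set of thieves that may still receive type \<open>i\<close>.
\<close>

definition valid :: "(nat \<Rightarrow> nat set) \<Rightarrow> nat list \<Rightarrow> (nat \<Rightarrow> nat option) \<Rightarrow> bool" where
  "valid x w h \<longleftrightarrow>
     (\<forall>p<length w. \<forall>c. h p = Some c \<longrightarrow> c \<in> x (w ! p)) \<and>
     (\<forall>p<length w. \<forall>q<length w. w ! p = w ! q \<longrightarrow> h p = h q \<longrightarrow> h p \<noteq> None \<longrightarrow> p = q)"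

text \<open>These positions begin the runs with a common owner; each \<open>None\<close> bead is a
  run by itself, because its owner is chosen individually at the end.\<close>

definition starts :: "nat \<Rightarrow> (nat \<Rightarrow> nat option) \<Rightarrow> nat set" where
  "starts n h = {p. p < n \<and> (p = 0 \<or> h p = None \<or> h p \<noteq> h (p - 1))}"

definition pieces :: "(nat \<Rightarrow> nat set) \<Rightarrow> nat list \<Rightarrow> nat" where
  "pieces x w = (LEAST N. \<exists>h. valid x w h \<and> card (starts (length w) h) = N)"

lemma finite_starts [simp]: "finite (starts n h)"
  by (rule finite_subset[of _ "{..<n}"]) (auto simp: starts_def)

lemma card_starts_le: "card (starts n h) \<le> n"
  using card_mono[of "{..<n}" "starts n h"] by (auto simp: starts_def)

lemma valid_None: "valid x w (\<lambda>_. None)"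
  by (simp add: valid_def)

lemma pieces_le: "valid x w h \<Longrightarrow> pieces x w \<le> card (starts (length w) h)"
  unfolding pieces_def by (rule Least_le) blast

lemma pieces_attained: "\<exists>h. valid x w h \<and> card (starts (length w) h) = pieces x w"
  unfolding pieces_def by (rule LeastI_ex) (use valid_None in blast)

lemma pieces_le_length: "pieces x w \<le> length w"
  using pieces_le[OF valid_None] card_starts_le order_trans by blast

text \<open>Optimal partial distributions of the two parts can be glued: for each type the two parts
  use disjoint sets of thieves, so nobody receives a type twice.\<close>

lemma pieces_append:
  assumes "\<And>i. y i \<union> z i \<subseteq> x i" "\<And>i. y i \<inter> z i = {}"
  shows "pieces x (u @ v) \<le> pieces y u + pieces z v"
proof -
  obtain f where f: "valid y u f" "card (starts (length u) f) = pieces y u"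
    using pieces_attained by blast
  obtain g where g: "valid z v g" "card (starts (length v) g) = pieces z v"
    using pieces_attained by blast
  define l where "l = length u"
  define h where "h p = (if p < l then f p else g (p - l))" for p
  have "valid x (u @ v) h"
    unfolding valid_def
  proof (intro conjI allI impI)
    fix p c assume "p < length (u @ v)" "h p = Some c"
    then show "c \<in> x ((u @ v) ! p)"
      using f(1) g(1) assms(1)[of "(u @ v) ! p"]
      by (cases "p < l") (auto simp: valid_def h_def l_def nth_append)
  next
    fix p q
    assume pq: "p < length (u @ v)" "q < length (u @ v)" "(u @ v) ! p = (u @ v) ! q"
      "h p = h q" "h p \<noteq> None"
    then obtain c where c: "h p = Some c" "h q = Some c" by auto
    have fm: "c \<in> y ((u @ v) ! p)" if "p < l" "h p = Some c" for p
      using f(1) that by (simp add: valid_def h_def l_def nth_append)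
    have gm: "c \<in> z ((u @ v) ! p)" if "p \<ge> l" "h p = Some c" "p < length (u @ v)" for p
    proof -
      have "p - l < length v" using that by (simp add: l_def)
      then show ?thesis using g(1) that by (simp add: valid_def h_def l_def nth_append)
    qed
    have disj: False if "c \<in> y i" "c \<in> z i" for i using assms(2)[of i] that by blast
    consider "p < l" "q < l" | "p < l" "q \<ge> l" | "p \<ge> l" "q < l" | "p \<ge> l" "q \<ge> l"
      by linarith
    then show "p = q"
    proof cases
      case 1
      then show ?thesis using f(1) pq by (auto simp: valid_def h_def l_def nth_append)
    next
      case 2
      then have "c \<in> y ((u @ v) ! p)" "c \<in> z ((u @ v) ! q)"
        using fm[of p] gm[of q] 2 c pq(1,2) by blast+
      then show ?thesis using disj pq(3) by metis
    next
      case 3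
      then have "c \<in> z ((u @ v) ! p)" "c \<in> y ((u @ v) ! q)"
        using fm[of q] gm[of p] 3 c pq(1,2) by blast+
      then show ?thesis using disj pq(3) by metis
    next
      case 4
      then have "p - l < length v" "q - l < length v" "v ! (p - l) = v ! (q - l)"
        "g (p - l) = g (q - l)" "g (p - l) \<noteq> None"
        using pq by (auto simp: h_def l_def nth_append)
      then have "p - l = q - l" using g(1) by (auto simp: valid_def)
      then show ?thesis using 4 by simp
    qed
  qed
  then have "pieces x (u @ v) \<le> card (starts (length (u @ v)) h)" by (rule pieces_le)
  \<comment> \<open>The junction costs nothing extra, since position 0 of \<open>v\<close> is
    already a start for \<open>g\<close>.\<close>
  also have "starts (length (u @ v)) h \<subseteq> starts l f \<union> (\<lambda>p. p + l) ` starts (length v) g"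
  proof
    fix p assume p: "p \<in> starts (length (u @ v)) h"
    show "p \<in> starts l f \<union> (\<lambda>p. p + l) ` starts (length v) g"
    proof (cases "p < l")
      case True
      then have "p - 1 < l" by simp
      then have "p \<in> starts l f" using p True by (auto simp: starts_def h_def l_def)
      then show ?thesis by simp
    next
      case False
      have "p - l \<in> starts (length v) g"
      proof (cases "p = l")
        case True
        then show ?thesis using p by (auto simp: starts_def l_def)
      next
        case neq: False
        then have "\<not> p - 1 < l" "p - 1 - l = p - l - 1" using False by auto
        then show ?thesis using p False neq by (auto simp: starts_def h_def l_def)
      qed
      then show ?thesis using False by (intro UnI2 image_eqI[of _ _ "p - l"]) auto
    qed
  qed
  then have "card (starts (length (u @ v)) h) \<le> card (starts l f \<union> (\<lambda>p. p + l) ` starts (length v) g)"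
    by (intro card_mono) auto
  also have "\<dots> \<le> card (starts l f) + card ((\<lambda>p. p + l) ` starts (length v) g)"
    by (rule card_Un_le)
  also have "\<dots> \<le> pieces y u + pieces z v"
    using f(2) g(2) card_image_le[of "starts (length v) g" "\<lambda>p. p + l"] by (simp add: l_def)
  finally show ?thesis .
qed

lemma pieces_distinct:
  assumes "distinct w" "\<And>i. i \<in> set w \<Longrightarrow> c \<in> x i"
  shows "pieces x w \<le> 1"
proof -
  have "valid x w (\<lambda>_. Some c)"
    using assms by (auto simp: valid_def nth_eq_iff_index_eq)
  then have "pieces x w \<le> card (starts (length w) (\<lambda>_. Some c))" by (rule pieces_le)
  also have "\<dots> \<le> card {0::nat}" by (rule card_mono) (auto simp: starts_def)
  finally show ?thesis by simp
qed

text \<open>Renaming the owners injectively preserves equality of owners, hence validity and the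
  starts. This moves a block of thieves to other numbers.\<close>

lemma pieces_rename:
  assumes "\<And>i. r ` x i \<subseteq> y i" "inj_on r (\<Union>i. x i)"
  shows "pieces y w \<le> pieces x w"
proof -
  obtain h where h: "valid x w h" "card (starts (length w) h) = pieces x w"
    using pieces_attained by blast
  define h' where "h' p = (if p < length w then map_option r (h p) else h p)" for p
  have mem: "c \<in> x (w ! p)" if "p < length w" "h p = Some c" for p c
    using h(1) that by (auto simp: valid_def)
  have eq: "h' p = h' q \<longleftrightarrow> h p = h q" if "p < length w" "q < length w" for p q
  proof (cases "h p"; cases "h q")
    fix c d assume cd: "h p = Some c" "h q = Some d"
    have "r c = r d \<longleftrightarrow> c = d"
      using mem[OF that(1) cd(1)] mem[OF that(2) cd(2)] by (intro inj_on_eq_iff[OF assms(2)]) auto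
    then show ?thesis using that cd by (simp add: h'_def)
  qed (use that in \<open>simp_all add: h'_def\<close>)
  have "valid y w h'"
    unfolding valid_def
  proof (intro conjI allI impI)
    fix p c assume p: "p < length w" "h' p = Some c"
    then obtain d where "h p = Some d" "c = r d" by (auto simp: h'_def)
    then show "c \<in> y (w ! p)" using mem[OF p(1)] assms(1) by blast
  next
    fix p q assume "p < length w" "q < length w" "w ! p = w ! q" "h' p = h' q" "h' p \<noteq> None"
    then show "p = q" using h(1) eq[of p q] by (simp add: valid_def h'_def)
  qed
  then have "pieces y w \<le> card (starts (length w) h')" by (rule pieces_le)
  also have "starts (length w) h' = starts (length w) h"
  proof (rule set_eqI)
    fix p
    show "p \<in> starts (length w) h' \<longleftrightarrow> p \<in> starts (length w) h"
    proof (cases "p < length w")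
      case True
      then have "h' p = h' (p - 1) \<longleftrightarrow> h p = h (p - 1)" by (intro eq) auto
      then show ?thesis using True by (simp add: starts_def h'_def)
    qed (simp add: starts_def)
  qed
  finally show ?thesis using h(2) by simp
qed

section \<open>Robustness under changing beads\<close>

definition hamming :: "'a list \<Rightarrow> 'a list \<Rightarrow> nat" where
  "hamming u v = card {p. p < length u \<and> u ! p \<noteq> v ! p}"

text \<open>Cut out every changed bead. This can create a start at the bead itself and at its
  successor, whence the factor 2.\<close>

lemma pieces_hamming:
  assumes "length u = length v"
  shows "pieces x u \<le> pieces x v + 2 * hamming u v"
proof -
  obtain h where h: "valid x v h" "card (starts (length v) h) = pieces x v"
    using pieces_attained by blast
  define D where "D = {p. p < length u \<and> u ! p \<noteq> v ! p}"
  have [simp]: "finite D" by (simp add: D_def)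
  define h' where "h' p = (if p \<in> D then None else h p)" for p
  have "valid x u h'"
    using h(1) assms unfolding valid_def h'_def D_def by auto
  then have "pieces x u \<le> card (starts (length u) h')" by (rule pieces_le)
  also have "\<dots> \<le> card (starts (length v) h \<union> (D \<union> Suc ` D))"
  proof (rule card_mono)
    show "starts (length u) h' \<subseteq> starts (length v) h \<union> (D \<union> Suc ` D)"
    proof
      fix p assume p: "p \<in> starts (length u) h'"
      show "p \<in> starts (length v) h \<union> (D \<union> Suc ` D)"
      proof (cases "p = 0 \<or> p \<in> D \<or> p - 1 \<in> D")
        case True
        then consider "p = 0" | "p \<in> D" | "p \<noteq> 0" "p - 1 \<in> D" by blast
        then show ?thesis
        proof cases
          case 3
          then have "p \<in> Suc ` D" by (intro image_eqI[of _ _ "p - 1"]) auto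
          then show ?thesis by blast
        qed (use p assms in \<open>auto simp: starts_def\<close>)
      next
        case False
        then show ?thesis using p assms by (auto simp: starts_def h'_def)
      qed
    qed
  qed auto
  also have "\<dots> \<le> card (starts (length v) h) + (card D + card (Suc ` D))"
    by (meson add_le_mono1 card_Un_le le_trans nat_add_left_cancel_le)
  also have "\<dots> = pieces x v + 2 * hamming u v"
    using h(2) by (simp add: card_image hamming_def D_def)
  finally show ?thesis .
qed

text \<open>Cutting wherever the owner changes makes the owner constant on each interval, so whole
  intervals can be handed out according to \<open>h\<close>.\<close>

lemma fair_cuts_of_owner:
  assumes xs: "xs \<in> necklaces k t 1"
    and bij: "\<And>i. i < t \<Longrightarrow> bij_betw h {p. p < length xs \<and> xs ! p = i} {..<k}"
  shows "fair_cuts k t 1 xs {p. 0 < p \<and> p < length xs \<and> h p \<noteq> h (p - 1)}"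
proof -
  define n where "n = length xs"
  define C where "C = {p. 0 < p \<and> p < n \<and> h p \<noteq> h (p - 1)}"
  have const: "h p = h a" if "a \<le> p" "p < b" "b \<le> n" "{a<..<b} \<inter> C = {}" for a b p
    using that
  proof (induction p)
    case (Suc p)
    show ?case
    proof (cases "a = Suc p")
      case False
      then have "a \<le> p" "p < b" using Suc.prems(1,2) by linarith+
      then have "h p = h a" using Suc.IH Suc.prems(3,4) by blast
      moreover have "Suc p \<in> {a<..<b}" using Suc.prems(1,2) False by simp
      then have "Suc p \<notin> C" using Suc.prems(4) by blast
      then have "h (Suc p) = h p" using Suc.prems(2,3) by (simp add: C_def)
      ultimately show ?thesis by simp
    qed simp
  qed simp
  have hk: "h p < k" if "p < n" for p
  proof -
    have "xs ! p < t" using xs that nth_mem[of p xs] by (auto simp: necklaces_def n_def simp del: nth_mem)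
    from bij[OF this] that show ?thesis by (auto simp: bij_betw_def n_def)
  qed
  define g where "g I = h (Min I)" for I
  have int: "I \<subseteq> {..<n} \<and> Min I \<in> I \<and> (\<forall>p\<in>I. h p = g I)"
    if "I \<in> cut_intervals n C" for I
  proof -
    from that obtain a b where I: "I = {a..<b}" "b \<in> insert n C" "a < b" "{a<..<b} \<inter> C = {}"
      unfolding cut_intervals_def by blast
    have b: "b \<le> n" using I(2) by (auto simp: C_def)
    have "Min I = a" unfolding I(1) using I(3) by (intro Min_eqI) auto
    moreover have "\<forall>p\<in>I. h p = g I"
      unfolding g_def \<open>Min I = a\<close>
    proof
      fix p assume "p \<in> I"
      then show "h p = h a" by (intro const[OF _ _ b I(4)]) (simp_all add: I(1))
    qed
    moreover have "I \<subseteq> {..<n}" "a \<in> I" using I(1,3) b by auto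
    ultimately show ?thesis by simp
  qed
  have cover: "\<exists>I\<in>cut_intervals n C. p \<in> I" if "p < n" for p
  proof -
    \<comment> \<open>The interval around \<open>p\<close> is bounded by the nearest cut or end on
      either side.\<close>
    define a where "a = Max {c \<in> insert 0 C. c \<le> p}"
    define b where "b = Min {c \<in> insert n C. p < c}"
    have "finite C" by (rule finite_subset[of _ "{..<n}"]) (auto simp: C_def)
    then have fin: "finite {c \<in> insert 0 C. c \<le> p}" "finite {c \<in> insert n C. p < c}" by auto
    have a: "a \<in> {c \<in> insert 0 C. c \<le> p}" unfolding a_def using fin by (intro Max_in) auto
    have b: "b \<in> {c \<in> insert n C. p < c}" unfolding b_def using fin that by (intro Min_in) auto
    have "{a<..<b} \<inter> C = {}"
    proof (rule ccontr)
      assume "{a<..<b} \<inter> C \<noteq> {}"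
      then obtain c where c: "c \<in> C" "a < c" "c < b" by auto
      show False
      proof (cases "c \<le> p")
        case True
        then have "c \<le> a" unfolding a_def using fin c by (intro Max_ge) auto
        then show False using c by simp
      next
        case False
        then have "b \<le> c" unfolding b_def using fin c by (intro Min_le) auto
        then show False using c by simp
      qed
    qed
    then have "{a..<b} \<in> cut_intervals n C"
      unfolding cut_intervals_def using a b by (intro CollectI exI[of _ a] exI[of _ b]) simp
    moreover have "p \<in> {a..<b}" using a b by simp
    ultimately show ?thesis by blast
  qed
  have "card {p \<in> \<Union>{I \<in> cut_intervals n C. g I = j}. xs ! p = i} = 1" if "j < k" "i < t" for i j
  proof -
    have "{p \<in> \<Union>{I \<in> cut_intervals n C. g I = j}. xs ! p = i} = {p. p < n \<and> xs ! p = i \<and> h p = j}"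
    proof (rule set_eqI)
      fix p
      have "(\<exists>I\<in>cut_intervals n C. g I = j \<and> p \<in> I) \<longleftrightarrow> p < n \<and> h p = j"
      proof
        assume "\<exists>I\<in>cut_intervals n C. g I = j \<and> p \<in> I"
        then obtain I where "I \<in> cut_intervals n C" "g I = j" "p \<in> I" by blast
        with int[OF this(1)] show "p < n \<and> h p = j" by blast
      next
        assume p: "p < n \<and> h p = j"
        then obtain I where I: "I \<in> cut_intervals n C" "p \<in> I" using cover by blast
        with int[OF this(1)] p show "\<exists>I\<in>cut_intervals n C. g I = j \<and> p \<in> I" by auto
      qed
      then show "p \<in> {p \<in> \<Union>{I \<in> cut_intervals n C. g I = j}. xs ! p = i} \<longleftrightarrow>
          p \<in> {p. p < n \<and> xs ! p = i \<and> h p = j}" by auto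
    qed
    also have "card \<dots> = 1"
    proof -
      have "j \<in> h ` {p. p < n \<and> xs ! p = i}" using bij[OF that(2)] that(1) by (simp add: bij_betw_def n_def)
      then obtain p where p: "p < n" "xs ! p = i" "h p = j" by auto
      have "q = p" if "q < n" "xs ! q = i" "h q = j" for q
        by (rule inj_onD[OF bij_betw_imp_inj_on[OF bij[OF \<open>i < t\<close>]]]) (use p that in \<open>simp_all add: n_def\<close>)
      then have "{p. p < n \<and> xs ! p = i \<and> h p = j} = {p}" using p by blast
      then show ?thesis by simp
    qed
    finally show ?thesis .
  qed
  moreover have "g \<in> cut_intervals n C \<rightarrow> {..<k}"
  proof
    fix I assume "I \<in> cut_intervals n C"
    from int[OF this] have "Min I < n" by blast
    then show "g I \<in> {..<k}" using hk by (simp add: g_def)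
  qed
  moreover have "C \<subseteq> {0<..<n}" by (auto simp: C_def)
  ultimately have "fair_cuts k t 1 xs C"
    unfolding fair_cuts_def n_def[symmetric] by blast
  then show ?thesis by (simp add: C_def n_def)
qed

text \<open>On each type a valid partial distribution is an injection from some of the
  \<open>k\<close> beads into the \<open>k\<close> thieves, so it extends to a bijection. The
  cut-out beads thus find owners.\<close>

lemma min_fair_cuts_le_pieces:
  assumes xs: "xs \<in> necklaces k t 1"
  shows "min_fair_cuts k t 1 xs \<le> pieces (\<lambda>_. {..<k}) xs"
proof -
  obtain h where h: "valid (\<lambda>_. {..<k}) xs h" "card (starts (length xs) h) = pieces (\<lambda>_. {..<k}) xs"
    using pieces_attained by blast
  define P where "P i = {p. p < length xs \<and> xs ! p = i}" for i
  have [simp]: "finite (P i)" for i by (simp add: P_def)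
  have "\<exists>g. bij_betw g (P i) {..<k} \<and> (\<forall>p\<in>P i. \<forall>c. h p = Some c \<longrightarrow> g p = c)" if "i < t" for i
  proof -
    define Q where "Q = {p \<in> P i. h p \<noteq> None}"
    define f where "f p = the (h p)" for p
    have inj: "inj_on f Q"
    proof (rule inj_onI)
      fix p q assume pq: "p \<in> Q" "q \<in> Q" "f p = f q"
      then have "h p = h q" "h p \<noteq> None" by (auto simp: Q_def f_def)
      then show "p = q" using h(1) pq by (simp add: valid_def Q_def P_def)
    qed
    have sub: "f ` Q \<subseteq> {..<k}"
      using h(1) by (auto simp: Q_def P_def f_def valid_def)
    have "card (P i) = k"
    proof -
      have "k = card {p. p < length xs \<and> i = xs ! p}"
        using xs that by (auto simp: necklaces_def count_list_eq_length_filter length_filter_conv_card)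
      also have "{p. p < length xs \<and> i = xs ! p} = P i" by (auto simp: P_def)
      finally show ?thesis by simp
    qed
    moreover have "card (f ` Q) = card Q" using inj by (rule card_image)
    ultimately have "card (P i - Q) = card ({..<k} - f ` Q)"
      using sub by (subst (1 2) card_Diff_subset) (auto simp: Q_def)
    then obtain b where b: "bij_betw b (P i - Q) ({..<k} - f ` Q)"
      using finite_same_card_bij[of "P i - Q" "{..<k} - f ` Q"] by auto
    define g where "g p = (if p \<in> Q then f p else b p)" for p
    have "bij_betw g (Q \<union> (P i - Q)) (f ` Q \<union> ({..<k} - f ` Q))"
    proof (rule bij_betw_combine)
      show "bij_betw g Q (f ` Q)"
        using inj by (simp add: bij_betw_def g_def inj_on_def)
      show "bij_betw g (P i - Q) ({..<k} - f ` Q)"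
        using b by (subst bij_betw_cong[of _ _ b]) (auto simp: g_def)
    qed auto
    moreover have "Q \<union> (P i - Q) = P i" "f ` Q \<union> ({..<k} - f ` Q) = {..<k}"
      using sub by (auto simp: Q_def)
    ultimately show ?thesis by (intro exI[of _ g]) (auto simp: g_def Q_def f_def)
  qed
  then obtain g where g: "\<And>i. i < t \<Longrightarrow> bij_betw (g i) (P i) {..<k}"
    "\<And>i p c. i < t \<Longrightarrow> p \<in> P i \<Longrightarrow> h p = Some c \<Longrightarrow> g i p = c" by metis
  define H where "H p = g (xs ! p) p" for p
  have bij: "bij_betw H (P i) {..<k}" if "i < t" for i
    using g(1)[OF that] by (subst bij_betw_cong[of _ _ "g i"]) (auto simp: H_def P_def)
  have ext: "H p = c" if "p < length xs" "h p = Some c" for p c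
  proof -
    have "xs ! p < t" using xs that nth_mem[of p xs] by (auto simp: necklaces_def simp del: nth_mem)
    then show ?thesis using g(2) that by (auto simp: H_def P_def)
  qed
  define C where "C = {p. 0 < p \<and> p < length xs \<and> H p \<noteq> H (p - 1)}"
  have "fair_cuts k t 1 xs C"
    unfolding C_def by (rule fair_cuts_of_owner[OF xs]) (use bij in \<open>auto simp: P_def\<close>)
  then have "min_fair_cuts k t 1 xs \<le> card C"
    unfolding min_fair_cuts_def by (intro Least_le) blast
  \<comment> \<open>At a position that is no start, the bead and its predecessor have the same owner
    under \<open>h\<close>, and \<open>H\<close> keeps that owner.\<close>
  also have "card C \<le> card (starts (length xs) h)"
  proof (rule card_mono)
    show "C \<subseteq> starts (length xs) h"
    proof
      fix p assume "p \<in> C"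
      then have p: "0 < p" "p < length xs" "H p \<noteq> H (p - 1)" by (auto simp: C_def)
      show "p \<in> starts (length xs) h"
      proof (rule ccontr)
        assume "p \<notin> starts (length xs) h"
        then obtain c where "h p = Some c" "h (p - 1) = h p"
          using p by (cases "h p") (auto simp: starts_def)
        then have "H p = c" "H (p - 1) = c" using ext[of p] ext[of "p - 1"] p by auto
        then show False using p by simp
      qed
    qed
  qed simp
  finally show ?thesis using h(2) by simp
qed


section \<open>The random assignment process\<close>

text \<open>The member of \<open>A\<close> with the least priority value, which is uniform in
  \<open>A\<close> when \<open>p\<close> is uniform. A single permutation serves all sets at once,
  so the same move can be applied to two states. For empty \<open>A\<close> the value is arbitrary;
  \<open>update\<close> then only removes it from an empty set.\<close>

definition select :: "(nat \<Rightarrow> nat) \<Rightarrow> nat set \<Rightarrow> nat" where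
  "select p A = inv p (Min (p ` A))"

lemma select_in:
  assumes "p permutes {..<B}" "finite A" "A \<noteq> {}"
  shows "select p A \<in> A"
proof -
  have "Min (p ` A) \<in> p ` A" using assms by (intro Min_in) auto
  then obtain a where "a \<in> A" "Min (p ` A) = p a" by blast
  then show ?thesis using permutes_inverses(2)[OF assms(1)] by (simp add: select_def)
qed

lemma permutations_nonempty: "{p. p permutes A} \<noteq> {}"
  using permutes_id by blast

lemma mean_permutations_const: "finite A \<Longrightarrow> mean {p. p permutes A} (\<lambda>_. c) = c"
  by (rule mean_const[OF finite_permutations permutations_nonempty])

text \<open>The two renamings cancel inside the minimum, since \<open>p \<circ> inv s\<close> takes
  the same values on the renamed set as \<open>p\<close> on \<open>A\<close>.\<close>

lemma select_image:
  assumes "p permutes {..<B}" "s permutes {..<B}"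
  shows "select (p \<circ> inv s) (s ` A) = s (select p A)"
proof -
  have "inv (p \<circ> inv s) = s \<circ> inv p"
    using assms by (simp add: o_inv_distrib permutes_bij permutes_inv_inv bij_imp_bij_inv permutes_inv)
  moreover have "(p \<circ> inv s) ` s ` A = p ` A"
    using assms by (simp add: image_image permutes_inverses(2))
  ultimately show ?thesis by (simp add: select_def)
qed

definition common :: "(nat \<Rightarrow> nat set) \<Rightarrow> nat list \<Rightarrow> nat set" where
  "common x e = (\<Inter>i\<in>set e. x i)"

text \<open>
  \<open>update\<close> processes the interval \<open>e\<close> with random priorities \<open>p\<close> in the state \<open>x\<close>. If some thief can
  take the whole interval, the first one does; otherwise each type in \<open>e\<close> still uses up one of its
  thieves. This makes \<open>card (x i)\<close> depend only on the number of intervals that contain \<open>i\<close>. A type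
  that occurs repeatedly in \<open>e\<close> loses one thief only; such intervals are cut up anyway.
\<close>

definition update :: "nat list \<times> (nat \<Rightarrow> nat) \<Rightarrow> (nat \<Rightarrow> nat set) \<Rightarrow> nat \<Rightarrow> nat set" where
  "update \<omega> x i = (if i \<in> set (fst \<omega>)
     then x i - {select (snd \<omega>) (if common x (fst \<omega>) \<noteq> {} then common x (fst \<omega>) else x i)}
     else x i)"

lemma update_subset: "update \<omega> x i \<subseteq> x i"
  by (auto simp: update_def)

locale assignment_process =
  fixes t B L :: nat
  assumes pos: "t > 0" "B > 0" "L > 0"
begin

section \<open>Transition operator and expectations of the process\<close>

definition moves :: "(nat list \<times> (nat \<Rightarrow> nat)) set" where
  "moves = words t L \<times> {p. p permutes {..<B}}"

text \<open>The transition operator of the Markov chain: \<open>(step ^^ n) f x\<close> is the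
  expectation of \<open>f\<close> after \<open>n\<close> further moves from state
  \<open>x\<close>.\<close>

definition step :: "((nat \<Rightarrow> nat set) \<Rightarrow> real) \<Rightarrow> (nat \<Rightarrow> nat set) \<Rightarrow> real" where
  "step f x = mean moves (\<lambda>\<omega>. f (update \<omega> x))"

definition states :: "(nat \<Rightarrow> nat set) set" where
  "states = {x. \<forall>i. x i \<subseteq> {..<B}}"

definition ex :: "nat \<Rightarrow> ((nat \<Rightarrow> nat set) \<Rightarrow> real) \<Rightarrow> real" where
  "ex n f = (step ^^ n) f (\<lambda>_. {..<B})"

lemma finite_moves [simp]: "finite moves"
  by (simp add: moves_def finite_permutations)

lemma moves_nonempty [simp]: "moves \<noteq> {}"
  using pos permutations_nonempty words_nonempty unfolding moves_def by blast

lemma mean_moves_fst: "mean moves (\<lambda>\<omega>. f (fst \<omega>)) = mean (words t L) f"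
  by (simp add: moves_def mean_Times mean_permutations_const)

lemma update_states: "x \<in> states \<Longrightarrow> update \<omega> x \<in> states"
  using update_subset[of \<omega> x] by (fastforce simp: states_def)

lemma initial_state: "(\<lambda>_. {..<B}) \<in> states"
  by (simp add: states_def)

lemma iter_Suc: "(step ^^ Suc n) f x = mean moves (\<lambda>\<omega>. (step ^^ n) f (update \<omega> x))"
  by (simp add: step_def)

lemma iter_mono:
  assumes "\<And>x. x \<in> states \<Longrightarrow> f x \<le> g x" "x \<in> states"
  shows "(step ^^ n) f x \<le> (step ^^ n) g x"
  using assms(2)
proof (induction n arbitrary: x)
  case (Suc n)
  then show ?case unfolding iter_Suc by (intro mean_mono) (auto intro: update_states)
qed (use assms in auto)

lemma iter_add: "(step ^^ n) (\<lambda>x. f x + g x) x = (step ^^ n) f x + (step ^^ n) g x"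
proof (induction n arbitrary: x)
  case (Suc n)
  then show ?case unfolding iter_Suc by (simp add: mean_add)
qed simp

lemma iter_cmult: "(step ^^ n) (\<lambda>x. c * f x) x = c * (step ^^ n) f x"
proof (induction n arbitrary: x)
  case (Suc n)
  then show ?case unfolding iter_Suc by (simp add: mean_cmult)
qed simp

lemma iter_const: "(step ^^ n) (\<lambda>_. c) x = c"
proof (induction n arbitrary: x)
  case (Suc n)
  then show ?case unfolding iter_Suc by (simp add: mean_const)
qed simp

lemma ex_mono: "(\<And>x. x \<in> states \<Longrightarrow> f x \<le> g x) \<Longrightarrow> ex n f \<le> ex n g"
  unfolding ex_def by (intro iter_mono initial_state)

lemma ex_cong: "(\<And>x. x \<in> states \<Longrightarrow> f x = g x) \<Longrightarrow> ex n f = ex n g"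
  by (intro antisym ex_mono) auto

lemma ex_add: "ex n (\<lambda>x. f x + g x) = ex n f + ex n g"
  by (simp add: ex_def iter_add)

lemma ex_cmult: "ex n (\<lambda>x. c * f x) = c * ex n f"
  by (simp add: ex_def iter_cmult)

lemma ex_const: "ex n (\<lambda>_. c) = c"
  by (simp add: ex_def iter_const)

lemma ex_diff: "ex n (\<lambda>x. f x - g x) = ex n f - ex n g"
  using ex_add[of n f "\<lambda>x. -1 * g x"] ex_cmult[of n "-1" g] by simp

lemma ex_sum: "ex n (\<lambda>x. \<Sum>j\<in>J. f j x) = (\<Sum>j\<in>J. ex n (f j))"
proof (induction J rule: infinite_finite_induct)
  case (insert j J)
  then show ?case by (simp add: ex_add)
qed (simp_all add: ex_const)

subsection \<open>Variance of Lipschitz statistics\<close>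

text \<open>Martingale argument, conditioning on the first move. The variance of the conditional
  expectation over that move is at most its mean square distance from any fixed number, here the
  value at the unmoved state \<open>x\<close>; so each move adds at most \<open>K\<close>.\<close>

lemma iter_variance:
  assumes "\<And>m x. m < n \<Longrightarrow> mean moves (\<lambda>\<omega>. ((step ^^ m) f (update \<omega> x) - (step ^^ m) f x)\<^sup>2) \<le> K"
  shows "(step ^^ n) (\<lambda>y. (f y - c)\<^sup>2) x \<le> n * K + ((step ^^ n) f x - c)\<^sup>2"
  using assms
proof (induction n arbitrary: x)
  case (Suc n)
  let ?Y = "\<lambda>\<omega>. (step ^^ n) f (update \<omega> x)"
  have "(step ^^ Suc n) (\<lambda>y. (f y - c)\<^sup>2) x \<le> mean moves (\<lambda>\<omega>. n * K + (?Y \<omega> - c)\<^sup>2)"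
    unfolding iter_Suc by (intro mean_mono Suc) auto
  also have "\<dots> = n * K + mean moves (\<lambda>\<omega>. (?Y \<omega> - c)\<^sup>2)"
    by (simp add: mean_add mean_const)
  also have "mean moves (\<lambda>\<omega>. (?Y \<omega> - c)\<^sup>2) \<le>
      mean moves (\<lambda>\<omega>. (?Y \<omega> - (step ^^ n) f x)\<^sup>2) + (mean moves ?Y - c)\<^sup>2"
    by (intro variance_le_mean_square) auto
  also have "mean moves (\<lambda>\<omega>. (?Y \<omega> - (step ^^ n) f x)\<^sup>2) \<le> K"
    by (rule Suc.prems) simp
  also have "mean moves ?Y = (step ^^ Suc n) f x"
    by (rule iter_Suc[symmetric])
  finally show ?case by (simp add: algebra_simps)
qed simp

definition disagree :: "(nat \<Rightarrow> nat set) \<Rightarrow> (nat \<Rightarrow> nat set) \<Rightarrow> nat set" where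
  "disagree x y = {i. i < t \<and> x i \<noteq> y i}"

lemma finite_disagree [simp]: "finite (disagree x y)"
  by (simp add: disagree_def)

text \<open>Both states are coupled by the same move. An interval that avoids all disagreements acts
  alike on both; any other interval spoils at most its own \<open>L\<close> types.\<close>

lemma card_disagree_update:
  assumes "\<omega> \<in> moves"
  shows "card (disagree (update \<omega> x) (update \<omega> y)) \<le>
    card (disagree x y) + L * of_bool (set (fst \<omega>) \<inter> disagree x y \<noteq> {})"
proof -
  obtain e p where \<omega>: "\<omega> = (e, p)" by force
  have e: "length e = L" "set e \<subseteq> {..<t}" using assms by (auto simp: moves_def words_def \<omega>)
  show ?thesis
  proof (cases "set e \<inter> disagree x y = {}")
    case True
    then have eq: "x i = y i" if "i \<in> set e" for i using e that by (auto simp: disagree_def)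
    then have "common x e = common y e" by (simp add: common_def)
    then have "disagree (update \<omega> x) (update \<omega> y) \<subseteq> disagree x y"
      using eq by (auto simp: disagree_def update_def \<omega>)
    then show ?thesis using True by (simp add: \<omega> card_mono)
  next
    case False
    have "disagree (update \<omega> x) (update \<omega> y) \<subseteq> disagree x y \<union> set e"
      by (auto simp: disagree_def update_def \<omega>)
    then have "card (disagree (update \<omega> x) (update \<omega> y)) \<le> card (disagree x y \<union> set e)"
      by (intro card_mono) auto
    also have "\<dots> \<le> card (disagree x y) + card (set e)" by (rule card_Un_le)
    also have "card (set e) \<le> L" using card_length[of e] e by simp
    finally show ?thesis using False by (simp add: \<omega>)
  qed
qed

text \<open>Under the coupling, with \<open>d\<close> disagreements, the interval meets one with
  probability at most \<open>L * d / t\<close> and then adds at most \<open>L\<close>. So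
  \<open>d\<close> grows in expectation by a factor of at most \<open>1 + L\<^sup>2 / t\<close> per
  move.\<close>

lemma iter_lipschitz:
  assumes "\<And>x y. \<bar>f x - f y\<bar> \<le> c * real (card (disagree x y))" "c \<ge> 0"
  shows "\<bar>(step ^^ n) f x - (step ^^ n) f y\<bar> \<le> c * (1 + (real L)\<^sup>2 / t) ^ n * real (card (disagree x y))"
proof (induction n arbitrary: x y)
  case (Suc n)
  let ?c = "c * (1 + (real L)\<^sup>2 / t) ^ n"
  have c: "?c \<ge> 0" using assms(2) by simp
  have "\<bar>(step ^^ Suc n) f x - (step ^^ Suc n) f y\<bar> \<le>
      mean moves (\<lambda>\<omega>. \<bar>(step ^^ n) f (update \<omega> x) - (step ^^ n) f (update \<omega> y)\<bar>)"
    unfolding iter_Suc mean_diff[symmetric] by (rule mean_abs_le)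
  also have "\<dots> \<le> mean moves (\<lambda>\<omega>. ?c * (real (card (disagree x y)) +
      L * of_bool (set (fst \<omega>) \<inter> disagree x y \<noteq> {})))"
  proof (intro mean_mono)
    fix \<omega> assume "\<omega> \<in> moves"
    from card_disagree_update[OF this, of x y]
    have "real (card (disagree (update \<omega> x) (update \<omega> y))) \<le>
        real (card (disagree x y)) + L * of_bool (set (fst \<omega>) \<inter> disagree x y \<noteq> {})"
      by (auto simp: of_bool_def split: if_splits)
    from order_trans[OF Suc mult_left_mono[OF this c]]
    show "\<bar>(step ^^ n) f (update \<omega> x) - (step ^^ n) f (update \<omega> y)\<bar> \<le>
       ?c * (real (card (disagree x y)) + L * of_bool (set (fst \<omega>) \<inter> disagree x y \<noteq> {}))" .
  qed
  also have "\<dots> = ?c * (real (card (disagree x y)) +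
      L * mean (words t L) (\<lambda>e. of_bool (set e \<inter> disagree x y \<noteq> {})))"
    by (simp add: mean_cmult mean_add mean_const mean_moves_fst[of "\<lambda>e. of_bool (set e \<inter> disagree x y \<noteq> {})"])
  also have "\<dots> \<le> ?c * (real (card (disagree x y)) + L * (real L * real (card (disagree x y)) / t))"
    using pos c by (intro mult_left_mono add_left_mono mean_words_meets) (auto simp: disagree_def)
  also have "\<dots> = c * (1 + (real L)\<^sup>2 / t) ^ Suc n * real (card (disagree x y))"
    by (simp add: power2_eq_square algebra_simps)
  finally show ?case .
qed (use assms in simp)

text \<open>A single move changes the state on at most \<open>L\<close> types, so the Lipschitz
  bound controls each term in the martingale argument.\<close>

lemma ex_variance:
  assumes "\<And>x y. \<bar>f x - f y\<bar> \<le> c * real (card (disagree x y))" "c \<ge> 0"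
  shows "ex n (\<lambda>x. (f x - ex n f)\<^sup>2) \<le> n * (c * (1 + (real L)\<^sup>2 / t) ^ n * L)\<^sup>2"
proof -
  have "mean moves (\<lambda>\<omega>. ((step ^^ m) f (update \<omega> x) - (step ^^ m) f x)\<^sup>2) \<le>
      (c * (1 + (real L)\<^sup>2 / t) ^ n * L)\<^sup>2" if "m < n" for m x
  proof -
    have "((step ^^ m) f (update \<omega> x) - (step ^^ m) f x)\<^sup>2 \<le> (c * (1 + (real L)\<^sup>2 / t) ^ n * L)\<^sup>2"
      if \<omega>: "\<omega> \<in> moves" for \<omega>
    proof -
      have "disagree (update \<omega> x) x \<subseteq> set (fst \<omega>)" by (auto simp: disagree_def update_def)
      then have "card (disagree (update \<omega> x) x) \<le> card (set (fst \<omega>))" by (intro card_mono) auto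
      also have "\<dots> \<le> L" using \<omega> card_length[of "fst \<omega>"] by (auto simp: moves_def words_def)
      finally have d: "card (disagree (update \<omega> x) x) \<le> L" .
      have "\<bar>(step ^^ m) f (update \<omega> x) - (step ^^ m) f x\<bar> \<le>
          c * (1 + (real L)\<^sup>2 / t) ^ m * real (card (disagree (update \<omega> x) x))"
        by (rule iter_lipschitz[OF assms])
      also have "\<dots> \<le> c * (1 + (real L)\<^sup>2 / t) ^ n * L"
        using d \<open>m < n\<close> assms(2) by (intro mult_mono power_increasing) auto
      finally show ?thesis by (rule abs_le_square_iff[THEN iffD1, OF order_trans]) simp
    qed
    then have "mean moves (\<lambda>\<omega>. ((step ^^ m) f (update \<omega> x) - (step ^^ m) f x)\<^sup>2) \<le>
      mean moves (\<lambda>\<omega>. (c * (1 + (real L)\<^sup>2 / t) ^ n * L)\<^sup>2)" by (intro mean_mono)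
    then show ?thesis by (simp add: mean_const)
  qed
  then have "(step ^^ n) (\<lambda>x. (f x - ex n f)\<^sup>2) (\<lambda>_. {..<B}) \<le>
      n * (c * (1 + (real L)\<^sup>2 / t) ^ n * L)\<^sup>2 + ((step ^^ n) f (\<lambda>_. {..<B}) - ex n f)\<^sup>2"
    by (rule iter_variance)
  then show ?thesis by (simp add: ex_def)
qed

subsection \<open>Symmetry between the thieves\<close>

text \<open>Renaming the thieves commutes with a move whose priorities are renamed too; an injective
  \<open>s\<close> also commutes with the intersection over the nonempty interval.\<close>

lemma update_image:
  assumes "\<omega> \<in> moves" "s permutes {..<B}"
  shows "update (fst \<omega>, snd \<omega> \<circ> inv s) (\<lambda>i. s ` x i) = (\<lambda>i. s ` update \<omega> x i)"
proof
  fix i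
  obtain e p where \<omega>: "\<omega> = (e, p)" by force
  have p: "p permutes {..<B}" and e: "set e \<noteq> {}"
    using assms(1) pos by (auto simp: \<omega> moves_def words_def)
  have inj: "inj s" using assms(2) by (rule permutes_inj)
  obtain j where "j \<in> set e" using e by (meson ex_in_conv)
  then have "common (\<lambda>i. s ` x i) e = s ` common x e"
    unfolding common_def by (intro image_INT[symmetric, OF inj]) auto
  then show "update (fst \<omega>, snd \<omega> \<circ> inv s) (\<lambda>i. s ` x i) i = s ` update \<omega> x i"
    using select_image[OF p assms(2)] by (auto simp: \<omega> update_def image_set_diff[OF inj])
qed

text \<open>Renaming the priorities permutes the moves and so preserves their uniform
  distribution.\<close>

lemma iter_symmetric:
  assumes "s permutes {..<B}"
  shows "(step ^^ n) f (\<lambda>i. s ` x i) = (step ^^ n) (\<lambda>y. f (\<lambda>i. s ` y i)) x"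
proof (induction n arbitrary: x)
  case (Suc n)
  let ?h = "\<lambda>\<omega>. (fst \<omega>, snd \<omega> \<circ> inv s)"
  have bij: "bij_betw ?h moves moves"
    by (rule bij_betw_byWitness[where f' = "\<lambda>\<omega>. (fst \<omega>, snd \<omega> \<circ> s)"])
      (use assms in \<open>auto simp: moves_def o_assoc[symmetric] permutes_inv_o permutes_compose permutes_inv\<close>)
  have "(step ^^ Suc n) f (\<lambda>i. s ` x i) = mean moves (\<lambda>\<omega>. (step ^^ n) f (update (?h \<omega>) (\<lambda>i. s ` x i)))"
    unfolding iter_Suc by (rule mean_bij[OF bij])
  also have "\<dots> = mean moves (\<lambda>\<omega>. (step ^^ n) f (\<lambda>i. s ` update \<omega> x i))"
    by (intro mean_cong) (simp add: update_image[OF _ assms])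
  also have "\<dots> = (step ^^ Suc n) (\<lambda>y. f (\<lambda>i. s ` y i)) x"
    unfolding iter_Suc Suc ..
  finally show ?case .
qed simp

lemma ex_symmetric:
  assumes "s permutes {..<B}"
  shows "ex n f = ex n (\<lambda>y. f (\<lambda>i. s ` y i))"
  using iter_symmetric[OF assms, of n f "\<lambda>_. {..<B}"] permutes_image[OF assms] by (simp add: ex_def)

text \<open>These statistics determine the first two moments of the number of thieves able to take a
  fresh interval; the diagonal \<open>c = d\<close> concerns a single thief.\<close>

definition miss :: "nat \<Rightarrow> nat \<Rightarrow> (nat \<Rightarrow> nat set) \<Rightarrow> real" where
  "miss c d x = real (card {i. i < t \<and> c \<in> x i \<and> d \<in> x i}) / t"

lemma ex_miss_permute:
  assumes "s permutes {..<B}"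
  shows "ex n (miss (s c) (s d)) = ex n (miss c d)"
proof -
  have "s a \<in> s ` A \<longleftrightarrow> a \<in> A" for a A
    using permutes_inj[OF assms] by (auto simp: inj_def)
  then show ?thesis
    unfolding ex_symmetric[OF assms, of n "miss (s c) (s d)"] by (simp add: miss_def[abs_def])
qed

lemma ex_miss_same:
  assumes "c < B" "d < B"
  shows "ex n (miss c c) = ex n (miss d d)"
  using ex_miss_permute[OF permutes_swap_id[of c "{..<B}" d], of n c c] assms by simp

lemma ex_miss_distinct:
  assumes "c < B" "c' < B" "c \<noteq> c'" "d < B" "d' < B" "d \<noteq> d'"
  shows "ex n (miss c c') = ex n (miss d d')"
proof -
  \<comment> \<open>The first transposition takes the pair to \<open>d\<close> and
    \<open>c2\<close>; exchanging \<open>c2\<close> with \<open>d'\<close> then fixes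
    \<open>d\<close>.\<close>
  define c2 where "c2 = Transposition.transpose c d c'"
  have c2: "c2 < B" "c2 \<noteq> d" using assms by (auto simp: c2_def Transposition.transpose_def)
  have "ex n (miss c c') = ex n (miss d c2)"
    using ex_miss_permute[OF permutes_swap_id[of c "{..<B}" d], of n c c'] assms by (simp add: c2_def)
  also have "\<dots> = ex n (miss d d')"
  proof -
    have "Transposition.transpose c2 d' d = d" using c2 assms by (auto simp: Transposition.transpose_def)
    then show ?thesis
      using ex_miss_permute[OF permutes_swap_id[of c2 "{..<B}" d'], of n d c2] assms c2 by simp
  qed
  finally show ?thesis .
qed

lemma miss_bounds: "0 \<le> miss c d x" "miss c d x \<le> 1"
proof -
  have "card {i. i < t \<and> c \<in> x i \<and> d \<in> x i} \<le> card {..<t}" by (intro card_mono) auto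
  then show "0 \<le> miss c d x" "miss c d x \<le> 1" using pos by (auto simp: miss_def)
qed

lemma ex_miss_bounds: "0 \<le> ex n (miss c d)" "ex n (miss c d) \<le> 1"
  using ex_mono[of "\<lambda>_. 0" "miss c d" n] ex_mono[of "miss c d" "\<lambda>_. 1" n] miss_bounds
  by (auto simp: ex_const)

lemma miss_lipschitz: "\<bar>miss c d x - miss c d y\<bar> \<le> 1 / t * real (card (disagree x y))"
proof -
  have *: "card {i. i < t \<and> c \<in> x i \<and> d \<in> x i} \<le> card {i. i < t \<and> c \<in> y i \<and> d \<in> y i} + card (disagree x y)"
    for x y
  proof -
    have "card {i. i < t \<and> c \<in> x i \<and> d \<in> x i} \<le> card ({i. i < t \<and> c \<in> y i \<and> d \<in> y i} \<union> disagree x y)"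
      by (intro card_mono) (auto simp: disagree_def)
    then show ?thesis using card_Un_le order_trans by blast
  qed
  have "disagree y x = disagree x y" by (auto simp: disagree_def)
  then have "\<bar>real (card {i. i < t \<and> c \<in> x i \<and> d \<in> x i}) - real (card {i. i < t \<and> c \<in> y i \<and> d \<in> y i})\<bar>
      \<le> real (card (disagree x y))"
    using *[of x y] *[of y x] unfolding \<open>disagree y x = disagree x y\<close> by linarith
  then show ?thesis using pos unfolding miss_def diff_divide_distrib[symmetric]
    by (simp add: divide_right_mono)
qed

subsection \<open>Concentration of the number of missing thieves\<close>

text \<open>The probability that a given type occurs in a uniform interval of length
  \<open>L\<close>.\<close>

definition hit :: real where
  "hit = 1 - (1 - 1 / real t) ^ L"

lemma mean_hit:
  assumes "i < t"
  shows "mean (words t L) (\<lambda>e. of_bool (i \<in> set e)) = hit"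
proof -
  have "prod_list (map (\<lambda>b. of_bool (b \<noteq> i)) e) = (of_bool (i \<notin> set e) :: real)" for e
    by (induction e) auto
  then have "mean (words t L) (\<lambda>e. of_bool (i \<notin> set e)) = mean {..<t} (\<lambda>b. of_bool (b \<noteq> i)) ^ L"
    using mean_words_prod_list[of t L "\<lambda>b. of_bool (b \<noteq> i)"] by simp
  moreover have "mean {..<t} (\<lambda>b. of_bool (b \<noteq> i)) = 1 - 1 / real t"
  proof -
    have "mean {..<t} (\<lambda>b. of_bool (b \<noteq> i)) = mean {..<t} (\<lambda>b. 1 - of_bool (b = i))"
      by (intro mean_cong) auto
    also have "\<dots> = 1 - mean {..<t} (\<lambda>b. of_bool (b = i))"
      using pos by (simp add: mean_diff mean_lessThan_const)
    also have "mean {..<t} (\<lambda>b. of_bool (b = i)) = 1 / real t"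
      using assms by (simp add: mean_def of_bool_def)
    finally show ?thesis .
  qed
  moreover have "mean (words t L) (\<lambda>e. of_bool (i \<in> set e)) = mean (words t L) (\<lambda>e. 1 - of_bool (i \<notin> set e))"
    by (intro mean_cong) auto
  ultimately show ?thesis
    using pos by (simp add: mean_diff mean_const hit_def)
qed

lemma hit_nonneg: "0 \<le> hit"
  using pos by (simp add: hit_def power_le_one)

lemma hit_le: "hit \<le> real L / real t"
  using mean_words_meets[of t "{0}" L] mean_hit[of 0] pos by simp

text \<open>Either choice in \<open>update\<close> lies in \<open>x i\<close> when the latter is
  nonempty, so the loss depends on the interval only; truncated subtraction covers empty
  \<open>x i\<close>.\<close>

lemma card_update:
  assumes "\<omega> \<in> moves" "x \<in> states"
  shows "card (update \<omega> x i) = card (x i) - of_bool (i \<in> set (fst \<omega>))"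
proof (cases "i \<in> set (fst \<omega>) \<and> x i \<noteq> {}")
  case True
  define A where "A = (if common x (fst \<omega>) \<noteq> {} then common x (fst \<omega>) else x i)"
  have fin: "finite (x i)" using assms(2) by (auto simp: states_def intro: finite_subset)
  have A: "A \<subseteq> x i" "A \<noteq> {}" using True by (auto simp: A_def common_def)
  have "select (snd \<omega>) A \<in> A"
    using assms(1) A finite_subset[OF A(1) fin] by (intro select_in[of _ B]) (auto simp: moves_def)
  then have "select (snd \<omega>) A \<in> x i" using A(1) by blast
  moreover have "update \<omega> x i = x i - {select (snd \<omega>) A}"
    using True by (simp add: update_def A_def)
  ultimately show ?thesis using True fin by (simp add: card_Diff_singleton)
qed (auto simp: update_def)

text \<open>
  The truncation at \<open>card (y i) = 0\<close> only decreases the deviation, as long as \<open>a\<close> stays nonnegative.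
\<close>

lemma iter_card_square:
  assumes "i < t" "x \<in> states" "real n * hit \<le> a"
  shows "(step ^^ n) (\<lambda>y. (real (card (y i)) - (a - n * hit))\<^sup>2) x \<le> n * hit + (real (card (x i)) - a)\<^sup>2"
  using assms(2,3)
proof (induction n arbitrary: x a)
  case (Suc n)
  let ?s = "real (card (x i))"
  have a: "real n * hit \<le> a - hit" using Suc.prems(2) by (simp add: algebra_simps)
  have "0 \<le> real n * hit" using hit_nonneg by simp
  then have "hit \<le> a" using a by linarith
  have "(step ^^ Suc n) (\<lambda>y. (real (card (y i)) - (a - Suc n * hit))\<^sup>2) x =
      mean moves (\<lambda>\<omega>. (step ^^ n) (\<lambda>y. (real (card (y i)) - ((a - hit) - n * hit))\<^sup>2) (update \<omega> x))"
    unfolding iter_Suc by (simp add: algebra_simps)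
  also have "\<dots> \<le> mean moves (\<lambda>\<omega>. n * hit + (real (card (update \<omega> x i)) - (a - hit))\<^sup>2)"
    by (intro mean_mono Suc.IH a update_states Suc.prems)
  also have "\<dots> = n * hit + mean moves (\<lambda>\<omega>. (real (card (update \<omega> x i)) - (a - hit))\<^sup>2)"
    by (simp add: mean_add mean_const)
  also have "mean moves (\<lambda>\<omega>. (real (card (update \<omega> x i)) - (a - hit))\<^sup>2) \<le> hit + (?s - a)\<^sup>2"
  proof (cases "card (x i) = 0")
    case True
    then have "mean moves (\<lambda>\<omega>. (real (card (update \<omega> x i)) - (a - hit))\<^sup>2) = mean moves (\<lambda>\<omega>. (a - hit)\<^sup>2)"
      by (intro mean_cong) (simp add: card_update Suc.prems power2_commute)
    also have "\<dots> = (a - hit)\<^sup>2" by (simp add: mean_const)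
    also have "\<dots> \<le> a\<^sup>2" using \<open>hit \<le> a\<close> hit_nonneg by (intro power_mono) auto
    finally show ?thesis using True hit_nonneg by simp
  next
    case False
    then have "mean moves (\<lambda>\<omega>. (real (card (update \<omega> x i)) - (a - hit))\<^sup>2) =
       mean moves (\<lambda>\<omega>. (?s - a + hit)\<^sup>2 + (1 - 2 * (?s - a + hit)) * of_bool (i \<in> set (fst \<omega>)))"
      by (intro mean_cong) (auto simp: card_update Suc.prems of_nat_diff power2_eq_square algebra_simps)
    also have "\<dots> = (?s - a + hit)\<^sup>2 + (1 - 2 * (?s - a + hit)) * hit"
      using mean_moves_fst[of "\<lambda>e. of_bool (i \<in> set e)"] mean_hit[OF assms(1)]
      by (simp add: mean_add mean_const mean_cmult)
    also have "\<dots> = (?s - a)\<^sup>2 + hit - hit\<^sup>2" by (simp add: power2_eq_square algebra_simps)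
    finally show ?thesis by simp
  qed
  finally show ?case by (simp add: algebra_simps)
qed simp

lemma ex_abs_le:
  assumes "ex n (\<lambda>x. (f x)\<^sup>2) \<le> r\<^sup>2" "r > 0"
  shows "ex n (\<lambda>x. \<bar>f x\<bar>) \<le> r"
proof -
  have "ex n (\<lambda>x. \<bar>f x\<bar>) \<le> ex n (\<lambda>x. 1 / (2 * r) * (f x)\<^sup>2 + r / 2)"
    by (intro ex_mono abs_le_am_gm assms(2))
  also have "\<dots> = 1 / (2 * r) * ex n (\<lambda>x. (f x)\<^sup>2) + r / 2"
    unfolding ex_add ex_cmult ex_const ..
  also have "\<dots> \<le> 1 / (2 * r) * r\<^sup>2 + r / 2"
    using assms by (intro add_right_mono mult_left_mono) auto
  also have "\<dots> = r" using assms(2) by (simp add: power2_eq_square)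
  finally show ?thesis .
qed

lemma ex_uminus: "ex n (\<lambda>x. - f x) = - ex n f"
  using ex_cmult[of n "-1" f] by simp

lemma ex_abs_bounds: "ex n f \<le> ex n (\<lambda>x. \<bar>f x\<bar>)" "- ex n (\<lambda>x. \<bar>f x\<bar>) \<le> ex n f"
proof -
  show "ex n f \<le> ex n (\<lambda>x. \<bar>f x\<bar>)" by (intro ex_mono) auto
  have "ex n (\<lambda>x. - \<bar>f x\<bar>) \<le> ex n f" by (intro ex_mono) auto
  then show "- ex n (\<lambda>x. \<bar>f x\<bar>) \<le> ex n f" by (simp add: ex_uminus)
qed

text \<open>The mean square deviation of \<open>card (x i)\<close> from \<open>a\<close> is at most
  \<open>n * hit \<le> B\<close>, so its mean is within \<open>sqrt B\<close> of
  \<open>a\<close>.\<close>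

lemma ex_card_bounds:
  assumes "i < t" "real n * hit \<le> B"
  defines "a \<equiv> B - n * hit"
  shows "a - sqrt B \<le> ex n (\<lambda>x. real (card (x i)))"
    and "ex n (\<lambda>x. (real (card (x i)))\<^sup>2) \<le> a\<^sup>2 + 2 * B * sqrt B + B"
proof -
  let ?y = "\<lambda>x. real (card (x i)) - a"
  have r: "sqrt B > 0" using pos by simp
  have sq: "ex n (\<lambda>x. (?y x)\<^sup>2) \<le> B"
    using iter_card_square[OF assms(1) initial_state, of n B] assms(2) by (simp add: ex_def a_def)
  then have abs: "ex n (\<lambda>x. \<bar>?y x\<bar>) \<le> sqrt B"
    using r by (intro ex_abs_le) auto
  have "ex n ?y = ex n (\<lambda>x. real (card (x i))) - a" by (simp add: ex_diff ex_const)
  then show "a - sqrt B \<le> ex n (\<lambda>x. real (card (x i)))"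
    using ex_abs_bounds(2)[of n ?y] abs by linarith
  have a: "0 \<le> a" "a \<le> B" using assms(2) hit_nonneg by (auto simp: a_def)
  have "ex n (\<lambda>x. (real (card (x i)))\<^sup>2) = ex n (\<lambda>x. (?y x)\<^sup>2 + (2 * a * ?y x + a\<^sup>2))"
    by (intro ex_cong) (simp add: power2_eq_square algebra_simps)
  also have "\<dots> = ex n (\<lambda>x. (?y x)\<^sup>2) + (2 * a * ex n ?y + a\<^sup>2)"
    unfolding ex_add ex_cmult ex_const ..
  also have "\<dots> \<le> B + (2 * a * sqrt B + a\<^sup>2)"
    using sq abs ex_abs_bounds(1)[of n ?y] a by (intro add_mono mult_left_mono) auto
  also have "2 * a * sqrt B \<le> 2 * B * sqrt B"
    using a by (intro mult_right_mono) auto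
  finally show "ex n (\<lambda>x. (real (card (x i)))\<^sup>2) \<le> a\<^sup>2 + 2 * B * sqrt B + B" by simp
qed

lemma miss_eq_mean: "miss c d x = mean {..<t} (\<lambda>i. of_bool (c \<in> x i) * of_bool (d \<in> x i))"
proof -
  have "(\<Sum>i<t. of_bool (c \<in> x i) * of_bool (d \<in> x i)) = (\<Sum>i<t. of_bool (c \<in> x i \<and> d \<in> x i) :: real)"
    by (intro sum.cong) auto
  also have "\<dots> = real (card {i. i < t \<and> c \<in> x i \<and> d \<in> x i})"
    by (simp add: of_bool_def sum.If_cases Int_def)
  finally show ?thesis by (simp add: miss_def mean_def)
qed

lemma card_eq_sum:
  assumes "A \<subseteq> {..<B}"
  shows "real (card A) = (\<Sum>c<B. of_bool (c \<in> A))"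
  using assms by (simp add: of_bool_def sum.If_cases Int_absorb1)

text \<open>Double counting of thieves, or pairs of thieves, against the types they miss.\<close>

lemma sum_miss:
  assumes "x \<in> states"
  shows "(\<Sum>c<B. miss c c x) = mean {..<t} (\<lambda>i. real (card (x i)))"
    and "(\<Sum>c<B. \<Sum>d<B. miss c d x) = mean {..<t} (\<lambda>i. (real (card (x i)))\<^sup>2)"
proof -
  have card: "real (card (x i)) = (\<Sum>c<B. of_bool (c \<in> x i))" for i
    using assms by (intro card_eq_sum) (auto simp: states_def)
  show "(\<Sum>c<B. miss c c x) = mean {..<t} (\<lambda>i. real (card (x i)))"
    by (simp only: miss_eq_mean card mean_sum of_bool_conj[symmetric] conj_absorb)
  show "(\<Sum>c<B. \<Sum>d<B. miss c d x) = mean {..<t} (\<lambda>i. (real (card (x i)))\<^sup>2)"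
    by (simp only: miss_eq_mean card mean_sum power2_eq_square sum_product)
qed

lemma ex_mean: "ex n (\<lambda>x. mean J (\<lambda>i. f i x)) = mean J (\<lambda>i. ex n (f i))"
proof -
  have "ex n (\<lambda>x. mean J (\<lambda>i. f i x)) = ex n (\<lambda>x. 1 / real (card J) * (\<Sum>i\<in>J. f i x))"
    by (simp add: mean_def)
  then show ?thesis unfolding ex_cmult ex_sum by (simp add: mean_def)
qed

text \<open>By symmetry all thieves have the same expectation, so it equals the average over
  thieves, which is known from the counts.\<close>

lemma ex_miss_lower:
  assumes "c < B" "real n * hit \<le> B"
  shows "(B - n * hit) / B - 1 / sqrt B \<le> ex n (miss c c)"
proof -
  have "B * ex n (miss c c) = (\<Sum>d<B. ex n (miss c c))" by simp
  also have "\<dots> = (\<Sum>d<B. ex n (miss d d))"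
    using assms by (intro sum.cong ex_miss_same) auto
  also have "\<dots> = ex n (\<lambda>x. mean {..<t} (\<lambda>i. real (card (x i))))"
    unfolding ex_sum[symmetric] by (intro ex_cong sum_miss)
  also have "\<dots> \<ge> mean {..<t} (\<lambda>i. (B - n * hit) - sqrt B)"
    unfolding ex_mean using assms by (intro mean_mono ex_card_bounds) auto
  finally have "(B - n * hit) - sqrt B \<le> B * ex n (miss c c)"
    using pos by (simp add: mean_lessThan_const)
  then have "((B - n * hit) - sqrt B) / B \<le> ex n (miss c c)"
    using pos by (simp add: field_simps)
  moreover have "sqrt B / B = 1 / sqrt B" using pos by (simp add: sqrt_divide_self_eq inverse_eq_divide)
  ultimately show ?thesis by (simp add: diff_divide_distrib)
qed

text \<open>By symmetry all pairs of distinct thieves share one expectation \<open>m\<close>, and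
  the sum over all pairs is the average second moment of the counts.\<close>

lemma ex_miss_upper:
  assumes "c < B" "d < B" "c \<noteq> d" "real n * hit \<le> B"
  shows "ex n (miss c d) \<le> ((B - n * hit) / B)\<^sup>2 + 3 / sqrt B"
proof -
  let ?a = "B - n * hit"
  define m where "m = ex n (miss c d)"
  define S1 where "S1 = mean {..<t} (\<lambda>i. ex n (\<lambda>x. real (card (x i))))"
  define S2 where "S2 = mean {..<t} (\<lambda>i. ex n (\<lambda>x. (real (card (x i)))\<^sup>2))"
  have s1: "(\<Sum>e<B. ex n (miss e e)) = S1"
    unfolding S1_def ex_mean[symmetric] ex_sum[symmetric] by (intro ex_cong sum_miss)
  have s2: "(\<Sum>e<B. \<Sum>f<B. ex n (miss e f)) = S2"
    unfolding S2_def ex_mean[symmetric] ex_sum[symmetric] by (intro ex_cong sum_miss)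
  have row: "(\<Sum>f<B. ex n (miss e f)) = ex n (miss e e) + (real B - 1) * m" if "e < B" for e
  proof -
    have "(\<Sum>f<B. ex n (miss e f)) = ex n (miss e e) + (\<Sum>f\<in>{..<B} - {e}. ex n (miss e f))"
      using that by (intro sum.remove) auto
    also have "(\<Sum>f\<in>{..<B} - {e}. ex n (miss e f)) = (\<Sum>f\<in>{..<B} - {e}. m)"
      unfolding m_def using that assms by (intro sum.cong ex_miss_distinct) auto
    finally show ?thesis using that by (simp add: of_nat_diff)
  qed
  have "S2 = (\<Sum>e<B. ex n (miss e e) + (real B - 1) * m)"
    unfolding s2[symmetric] by (intro sum.cong row) auto
  then have eq: "S2 = S1 + B * (real B - 1) * m" by (simp add: sum.distrib s1)
  \<comment> \<open>The diagonal terms are at least as large on average as all terms, so discarding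
    them cannot raise the average: \<open>B\<^sup>2 * m \<le> S2\<close>.\<close>
  have "S2 \<le> B * S1"
    unfolding S1_def S2_def mean_cmult[symmetric] ex_cmult[symmetric]
  proof (intro mean_mono ex_mono)
    fix i x assume "x \<in> states"
    then have "card (x i) \<le> B" using card_mono[of "{..<B}" "x i"] by (simp add: states_def)
    then show "(real (card (x i)))\<^sup>2 \<le> B * real (card (x i))"
      by (simp add: power2_eq_square mult_right_mono)
  qed
  then have "B * (S2 - S1) \<le> (real B - 1) * S2" by (simp add: algebra_simps)
  moreover have "B * (S2 - S1) = (real B - 1) * ((real B)\<^sup>2 * m)"
    by (simp add: eq power2_eq_square)
  ultimately have "(real B - 1) * ((real B)\<^sup>2 * m) \<le> (real B - 1) * S2" by simp
  moreover have "real B - 1 > 0" using assms by linarith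
  ultimately have "(real B)\<^sup>2 * m \<le> S2" by simp
  also have "S2 \<le> mean {..<t} (\<lambda>i. ?a\<^sup>2 + 2 * B * sqrt B + B)"
    unfolding S2_def using assms by (intro mean_mono ex_card_bounds) auto
  also have "\<dots> = ?a\<^sup>2 + 2 * B * sqrt B + B" using pos by (simp add: mean_lessThan_const)
  also have "\<dots> \<le> ?a\<^sup>2 + 3 * B * sqrt B"
    using pos mult_left_mono[of 1 "sqrt B" B] by simp
  finally have "m \<le> (?a\<^sup>2 + 3 * B * sqrt B) / (real B)\<^sup>2"
    using pos by (simp add: pos_le_divide_eq mult.commute)
  also have "\<dots> = (?a / B)\<^sup>2 + 3 * (sqrt B / B)"
    using pos by (simp add: add_divide_distrib power_divide power2_eq_square)
  also have "sqrt B / B = 1 / sqrt B" using pos by (simp add: sqrt_divide_self_eq inverse_eq_divide)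
  finally show ?thesis unfolding m_def by simp
qed

subsection \<open>The probability that no thief can take an interval\<close>

lemma card_common:
  assumes "x \<in> states" "e \<in> words t L"
  shows "real (card (common x e)) = (\<Sum>c<B. prod_list (map (\<lambda>i. of_bool (c \<in> x i)) e))"
proof -
  have "prod_list (map (\<lambda>i. of_bool (c \<in> x i)) e) = (of_bool (c \<in> common x e) :: real)" for c
    by (induction e) (auto simp: common_def)
  moreover have "common x e \<subseteq> {..<B}"
  proof -
    have "e \<noteq> []" using assms pos by (auto simp: words_def)
    then obtain j where "j \<in> set e" by (cases e) auto
    then show ?thesis using assms(1) by (fastforce simp: common_def states_def)
  qed
  ultimately show ?thesis by (simp only: card_eq_sum)
qed

text \<open>Expand the square into pairs of thieves; by independence of the letters, two thieves
  both miss the whole interval with probability \<open>miss c d x ^ L\<close>.\<close>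

lemma mean_card_common:
  assumes "x \<in> states"
  shows "mean (words t L) (\<lambda>e. (real (card (common x e)) - \<mu>)\<^sup>2) =
    (\<Sum>c<B. \<Sum>d<B. miss c d x ^ L) - 2 * \<mu> * (\<Sum>c<B. miss c c x ^ L) + \<mu>\<^sup>2"
proof -
  let ?f = "\<lambda>c i. of_bool (c \<in> x i) :: real"
  have 1: "mean (words t L) (\<lambda>e. real (card (common x e))) = (\<Sum>c<B. miss c c x ^ L)"
  proof -
    have "mean (words t L) (\<lambda>e. real (card (common x e))) =
        mean (words t L) (\<lambda>e. \<Sum>c<B. prod_list (map (?f c) e))"
      using assms by (intro mean_cong card_common)
    also have "\<dots> = (\<Sum>c<B. mean {..<t} (?f c) ^ L)" by (simp add: mean_sum mean_words_prod_list)
    also have "\<dots> = (\<Sum>c<B. miss c c x ^ L)" by (simp add: miss_eq_mean flip: of_bool_conj)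
    finally show ?thesis .
  qed
  have prod: "prod_list (map f e) * prod_list (map g e) = prod_list (map (\<lambda>i. f i * g i) e)"
    for f g :: "nat \<Rightarrow> real" and e by (induction e) auto
  have 2: "mean (words t L) (\<lambda>e. (real (card (common x e)))\<^sup>2) = (\<Sum>c<B. \<Sum>d<B. miss c d x ^ L)"
  proof -
    have "mean (words t L) (\<lambda>e. (real (card (common x e)))\<^sup>2) =
        mean (words t L) (\<lambda>e. \<Sum>c<B. \<Sum>d<B. prod_list (map (\<lambda>i. ?f c i * ?f d i) e))"
      using assms by (intro mean_cong) (simp only: card_common power2_eq_square sum_product prod)
    also have "\<dots> = (\<Sum>c<B. \<Sum>d<B. miss c d x ^ L)"
      by (simp only: mean_sum mean_words_prod_list miss_eq_mean)
    finally show ?thesis .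
  qed
  have "mean (words t L) (\<lambda>e. (real (card (common x e)) - \<mu>)\<^sup>2) =
    mean (words t L) (\<lambda>e. (real (card (common x e)))\<^sup>2 - 2 * \<mu> * real (card (common x e)) + \<mu>\<^sup>2)"
    by (intro mean_cong) (simp add: power2_diff algebra_simps)
  also have "\<dots> = (\<Sum>c<B. \<Sum>d<B. miss c d x ^ L) - 2 * \<mu> * (\<Sum>c<B. miss c c x ^ L) + \<mu>\<^sup>2"
    using pos unfolding mean_add mean_diff mean_cmult 1 2 by (simp add: mean_const)
  finally show ?thesis .
qed

text \<open>The variance bound gives mean deviation at most \<open>\<eta>\<close>, and the
  \<open>L\<close>-th power is \<open>L\<close>-Lipschitz on the unit interval.\<close>

lemma ex_miss_power:
  fixes \<eta> :: real
  assumes "n * (1 / t * (1 + (real L)\<^sup>2 / t) ^ n * L)\<^sup>2 \<le> \<eta>\<^sup>2" "\<eta> > 0"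
  shows "\<bar>ex n (\<lambda>x. miss c d x ^ L) - ex n (miss c d) ^ L\<bar> \<le> L * \<eta>"
proof -
  let ?m = "ex n (miss c d)"
  note m = ex_miss_bounds[of n c d]
  have "ex n (\<lambda>x. (miss c d x - ?m)\<^sup>2) \<le> n * (1 / t * (1 + (real L)\<^sup>2 / t) ^ n * L)\<^sup>2"
    using miss_lipschitz by (intro ex_variance) auto
  then have \<eta>: "ex n (\<lambda>x. \<bar>miss c d x - ?m\<bar>) \<le> \<eta>"
    using assms by (intro ex_abs_le) auto
  let ?g = "\<lambda>x. miss c d x ^ L - ?m ^ L"
  have "ex n (\<lambda>x. \<bar>?g x\<bar>) \<le> ex n (\<lambda>x. L * \<bar>miss c d x - ?m\<bar>)"
    using m miss_bounds norm_power_diff[of _ ?m L] by (intro ex_mono) auto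
  also have "\<dots> \<le> L * \<eta>" unfolding ex_cmult using \<eta> by (intro mult_left_mono) auto
  finally have "ex n (\<lambda>x. \<bar>?g x\<bar>) \<le> L * \<eta>" .
  then show ?thesis using ex_abs_bounds[of n ?g] by (simp add: ex_diff ex_const)
qed

definition stuck :: "(nat \<Rightarrow> nat set) \<Rightarrow> real" where
  "stuck x = mean (words t L) (\<lambda>e. of_bool (common x e = {}))"

text \<open>Chebyshev's inequality: an empty \<open>common x e\<close> deviates from
  \<open>\<mu>\<close> by all of \<open>\<mu>\<close>.\<close>

lemma stuck_le:
  assumes "x \<in> states" "\<mu> > 0"
  shows "stuck x \<le> 1 / \<mu>\<^sup>2 *
    ((\<Sum>c<B. \<Sum>d<B. miss c d x ^ L) - 2 * \<mu> * (\<Sum>c<B. miss c c x ^ L) + \<mu>\<^sup>2)"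
proof -
  have "stuck x \<le> mean (words t L) (\<lambda>e. 1 / \<mu>\<^sup>2 * (real (card (common x e)) - \<mu>)\<^sup>2)"
    unfolding stuck_def using assms by (intro mean_mono) (auto simp: of_bool_def)
  then show ?thesis unfolding mean_cmult mean_card_common[OF assms(1)] .
qed

lemma power_perturb:
  fixes u v s :: real
  assumes "0 \<le> u" "0 \<le> v" "v \<le> 1" "u \<le> v + s" "u \<le> 1" "0 \<le> s"
  shows "u ^ L \<le> v ^ L + L * s"
proof (cases "u \<le> v")
  case True
  then have "u ^ L \<le> v ^ L" using assms by (intro power_mono) auto
  then show ?thesis using assms by (simp add: add_increasing2)
next
  case False
  have "\<bar>u ^ L - v ^ L\<bar> \<le> L * \<bar>u - v\<bar>" using assms norm_power_diff[of u v L] by simp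
  also have "\<dots> \<le> L * s" using assms False by (intro mult_left_mono) auto
  finally show ?thesis by simp
qed

text \<open>Average the Chebyshev bound. The powers are close to \<open>q ^ L\<close> for one thief
  and at most about \<open>q ^ (2 * L)\<close> for two, so the main terms cancel; the errors are
  divided by \<open>\<mu>\<^sup>2\<close>, where \<open>q \<ge> \<delta>\<close>.\<close>

lemma ex_stuck_le:
  fixes \<eta> \<delta> :: real
  assumes \<eta>: "n * (1 / t * (1 + (real L)\<^sup>2 / t) ^ n * L)\<^sup>2 \<le> \<eta>\<^sup>2" "\<eta> > 0"
    and \<delta>: "0 < \<delta>" "real n * hit \<le> (1 - \<delta>) * B"
  shows "ex n stuck \<le> (6 * L / sqrt B + 3 * L * \<eta>) / \<delta> ^ (2 * L)"
proof -
  \<comment> \<open>\<open>q\<close> approximates the fraction of types a thief still misses, and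
    \<open>\<mu>\<close> the expected number of thieves able to take an interval.\<close>
  define q where "q = (B - n * hit) / B"
  define \<mu> where "\<mu> = B * q ^ L"
  define r where "r = sqrt B"
  have r: "r > 0" "r\<^sup>2 = B" "r \<ge> 1" using pos by (auto simp: r_def)
  have q: "\<delta> \<le> q" "q \<le> 1" using \<delta> pos hit_nonneg by (auto simp: q_def field_simps)
  have qL: "q ^ L \<le> 1" "q ^ L > 0" using q \<delta>(1) by (auto intro: power_le_one)
  have \<mu>: "\<mu> > 0" using qL pos by (simp add: \<mu>_def)
  have nh: "real n * hit \<le> B"
    using \<delta> pos by (smt (verit) mult_left_le_one_le mult_nonneg_nonneg of_nat_0_le_iff mult_right_mono mult_1)
  note m = ex_miss_bounds[of n]
  have low: "q ^ L - L / r - L * \<eta> \<le> ex n (\<lambda>x. miss c c x ^ L)" if "c < B" for c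
  proof -
    have "q ^ L \<le> ex n (miss c c) ^ L + L * (1 / r)"
      using ex_miss_lower[OF that nh] q \<delta>(1) m[of c c] r by (intro power_perturb) (auto simp: q_def r_def)
    then show ?thesis using ex_miss_power[OF \<eta>, of c c] by (auto simp: abs_le_iff)
  qed
  \<comment> \<open>The trivial bound 1 suffices on the diagonal, which has only \<open>B\<close> of
    the \<open>B\<^sup>2\<close> pairs.\<close>
  have up: "ex n (\<lambda>x. miss c d x ^ L) \<le> of_bool (c = d) + (q ^ (2 * L) + 3 * L / r + L * \<eta>)"
    if "c < B" "d < B" for c d
  proof (cases "c = d")
    case True
    have "ex n (\<lambda>x. miss c d x ^ L) \<le> ex n (\<lambda>_. 1)"
      using miss_bounds by (intro ex_mono power_le_one) auto
    moreover have "0 \<le> q ^ (2 * L) + 3 * L / r + L * \<eta>"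
      using q \<delta>(1) r \<eta>(2) by (intro add_nonneg_nonneg) auto
    ultimately show ?thesis using True by (simp add: ex_const)
  next
    case False
    have "ex n (miss c d) ^ L \<le> (q\<^sup>2) ^ L + L * (3 / r)"
      using ex_miss_upper[OF that False nh] q \<delta>(1) m[of c d] r
      by (intro power_perturb) (auto simp: q_def r_def intro: power_le_one)
    then show ?thesis using ex_miss_power[OF \<eta>, of c d] False
      by (auto simp: abs_le_iff power_mult mult.commute[of _ 3])
  qed
  have "ex n stuck \<le> ex n (\<lambda>x. 1 / \<mu>\<^sup>2 *
      ((\<Sum>c<B. \<Sum>d<B. miss c d x ^ L) - 2 * \<mu> * (\<Sum>c<B. miss c c x ^ L) + \<mu>\<^sup>2))"
    using \<mu> by (intro ex_mono stuck_le)
  also have "\<dots> = 1 / \<mu>\<^sup>2 * ((\<Sum>c<B. \<Sum>d<B. ex n (\<lambda>x. miss c d x ^ L)) -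
      2 * \<mu> * (\<Sum>c<B. ex n (\<lambda>x. miss c c x ^ L)) + \<mu>\<^sup>2)"
    unfolding ex_cmult ex_add ex_diff ex_sum ex_const ..
  also have "\<dots> \<le> 1 / \<mu>\<^sup>2 * ((\<Sum>c<B. \<Sum>d<B. of_bool (c = d) + (q ^ (2 * L) + 3 * L / r + L * \<eta>)) -
      2 * \<mu> * (\<Sum>c<B. q ^ L - L / r - L * \<eta>) + \<mu>\<^sup>2)"
    using \<mu> by (intro mult_left_mono add_right_mono diff_mono sum_mono up low) auto
  also have "(\<Sum>c<B. \<Sum>d<B. of_bool (c = d) + (q ^ (2 * L) + 3 * L / r + L * \<eta>)) =
      B + B * (B * (q ^ (2 * L) + 3 * L / r + L * \<eta>))"
    by (simp add: sum.distrib of_bool_def) (simp only: distrib_left mult_1_right)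
  also have "(\<Sum>c<B. q ^ L - L / r - L * \<eta>) = B * (q ^ L - L / r - L * \<eta>)" by simp
  \<comment> \<open>With \<open>\<mu> = B * q ^ L\<close> the terms of order
    \<open>B\<^sup>2 * q ^ (2 * L)\<close> cancel.\<close>
  also have "B + B * (B * (q ^ (2 * L) + 3 * L / r + L * \<eta>)) - 2 * \<mu> * (B * (q ^ L - L / r - L * \<eta>)) + \<mu>\<^sup>2 =
      B + (real B)\<^sup>2 * (3 * L / r + L * \<eta> + 2 * q ^ L * (L / r + L * \<eta>))"
    unfolding \<mu>_def mult_2 power_add by (simp add: power2_eq_square algebra_simps)
  also have "\<dots> \<le> (real B)\<^sup>2 * (6 * L / r + 3 * L * \<eta>)"
  proof -
    have "2 * q ^ L * (L / r + L * \<eta>) \<le> 2 * (L / r + L * \<eta>)"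
      using qL r \<eta>(2) by (intro mult_right_mono) auto
    then have 1: "3 * L / r + L * \<eta> + 2 * q ^ L * (L / r + L * \<eta>) \<le> 5 * L / r + 3 * L * \<eta>"
      unfolding of_nat_mult of_nat_numeral by argo
    \<comment> \<open>The diagonal contribution \<open>B\<close> is absorbed into the error of order
      \<open>L / r\<close>, as \<open>r\<^sup>2 = B\<close>.\<close>
    have "real B = (real B)\<^sup>2 * (1 / r\<^sup>2)"
      unfolding r(2) using pos by (simp add: power2_eq_square)
    also have "1 / r\<^sup>2 \<le> L / r"
    proof -
      have "1 / r\<^sup>2 \<le> 1 / r" using r(1,3) by (intro divide_left_mono) (auto simp: power2_eq_square)
      also have "\<dots> \<le> L / r" using r pos by (intro divide_right_mono) auto
      finally show ?thesis .
    qed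
    finally have 2: "real B \<le> (real B)\<^sup>2 * (L / r)" by (simp add: mult_left_mono)
    show ?thesis using 2 mult_left_mono[OF 1, of "(real B)\<^sup>2"] by (simp add: algebra_simps)
  qed
  finally have "ex n stuck \<le> 1 / \<mu>\<^sup>2 * ((real B)\<^sup>2 * (6 * L / r + 3 * L * \<eta>))"
    using \<mu> by (simp add: mult_left_mono divide_right_mono)
  also have "\<dots> = (6 * L / r + 3 * L * \<eta>) / q ^ (2 * L)"
    using pos by (simp add: \<mu>_def power_mult_distrib power_mult[symmetric] mult.commute)
  also have "\<dots> \<le> (6 * L / r + 3 * L * \<eta>) / \<delta> ^ (2 * L)"
    using q \<delta>(1) r \<eta>(2) by (intro divide_left_mono power_mono mult_pos_pos) auto
  finally show ?thesis by (simp add: r_def)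
qed

subsection \<open>The expected number of pieces\<close>

text \<open>In the good case the selected thief takes the interval as one piece and is struck off
  its types, so the rest can be distributed independently. Otherwise all \<open>L\<close> beads are
  cut out, and the smaller sets left by \<open>update\<close> remain admissible.\<close>

lemma pieces_update:
  assumes "\<omega> \<in> moves" "x \<in> states" "length (fst \<omega>) = L"
  shows "pieces x (fst \<omega> @ v) \<le>
    1 + L * (of_bool (\<not> distinct (fst \<omega>)) + of_bool (common x (fst \<omega>) = {})) + pieces (update \<omega> x) v"
proof (cases "distinct (fst \<omega>) \<and> common x (fst \<omega>) \<noteq> {}")
  case True
  let ?e = "fst \<omega>"
  define c where "c = select (snd \<omega>) (common x ?e)"
  define y where "y i = (if i \<in> set ?e then {c} else {})" for i
  have "finite (common x ?e)"
  proof -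
    have "?e \<noteq> []" using assms(3) pos by auto
    then obtain j where "j \<in> set ?e" by (cases ?e) auto
    then have "common x ?e \<subseteq> {..<B}" using assms(2) by (fastforce simp: common_def states_def)
    then show ?thesis by (rule finite_subset) simp
  qed
  then have c: "c \<in> common x ?e"
    unfolding c_def using True assms(1) by (intro select_in[of _ B]) (auto simp: moves_def)
  have "pieces x (?e @ v) \<le> pieces y ?e + pieces (update \<omega> x) v"
  proof (rule pieces_append)
    fix i
    show "y i \<union> update \<omega> x i \<subseteq> x i"
      using c update_subset[of \<omega> x i] by (auto simp: y_def common_def)
    show "y i \<inter> update \<omega> x i = {}"
      using True by (auto simp: y_def update_def c_def)
  qed
  moreover have "pieces y ?e \<le> 1"
    using True by (intro pieces_distinct[where c = c]) (auto simp: y_def)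
  ultimately show ?thesis using True by simp
next
  case False
  have "pieces x (fst \<omega> @ v) \<le> pieces (\<lambda>_. {}) (fst \<omega>) + pieces (update \<omega> x) v"
    using update_subset[of \<omega> x] by (intro pieces_append) auto
  also have "pieces (\<lambda>_. {}) (fst \<omega>) \<le> L" using pieces_le_length[of "\<lambda>_. {}" "fst \<omega>"] assms(3) by simp
  finally show ?thesis using False by auto
qed

text \<open>Sum over the times \<open>m\<close> of the expected cost of the next interval: one
  piece, plus \<open>L\<close> if it repeats a type or is stuck.\<close>

lemma mean_pieces_le_iter:
  assumes "x \<in> states"
  shows "mean (words t (n * L)) (\<lambda>w. real (pieces x w)) \<le>
    (\<Sum>m<n. (step ^^ m) (\<lambda>y. 1 + L * ((real L)\<^sup>2 / t + stuck y)) x)"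
  using assms
proof (induction n arbitrary: x)
  case 0
  then show ?case using pieces_le_length[of x "[]"] by (simp add: words_0 mean_def)
next
  case (Suc n)
  let ?g = "\<lambda>y. 1 + L * ((real L)\<^sup>2 / t + stuck y)"
  let ?F = "\<lambda>x n. mean (words t (n * L)) (\<lambda>w. real (pieces x w))"
  have "?F x (Suc n) = mean (words t L) (\<lambda>e. mean (words t (n * L)) (\<lambda>v. real (pieces x (e @ v))))"
    by (simp add: mean_words_append)
  also have "\<dots> = mean moves (\<lambda>\<omega>. mean (words t (n * L)) (\<lambda>v. real (pieces x (fst \<omega> @ v))))"
    by (rule mean_moves_fst[symmetric])
  also have "\<dots> \<le> mean moves (\<lambda>\<omega>. mean (words t (n * L)) (\<lambda>v.
      (1 + L * (of_bool (\<not> distinct (fst \<omega>)) + of_bool (common x (fst \<omega>) = {}))) + real (pieces (update \<omega> x) v)))"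
  proof (intro mean_mono)
    fix \<omega> v assume "\<omega> \<in> moves"
    then have "length (fst \<omega>) = L" by (auto simp: moves_def words_def)
    from of_nat_mono[OF pieces_update[OF \<open>\<omega> \<in> moves\<close> Suc.prems this, of v], where 'a = real]
    show "real (pieces x (fst \<omega> @ v)) \<le>
      1 + L * (of_bool (\<not> distinct (fst \<omega>)) + of_bool (common x (fst \<omega>) = {})) + real (pieces (update \<omega> x) v)"
      by (simp add: of_nat_of_bool)
  qed
  also have "\<dots> = mean moves (\<lambda>\<omega>. 1 + L * (of_bool (\<not> distinct (fst \<omega>)) + of_bool (common x (fst \<omega>) = {})))
      + mean moves (\<lambda>\<omega>. ?F (update \<omega> x) n)"
    using pos by (simp add: mean_add mean_const)
  also have "mean moves (\<lambda>\<omega>. 1 + L * (of_bool (\<not> distinct (fst \<omega>)) + of_bool (common x (fst \<omega>) = {}))) =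
      1 + L * (mean (words t L) (\<lambda>e. of_bool (\<not> distinct e)) + stuck x)"
    using mean_moves_fst[of "\<lambda>e. 1 + L * (of_bool (\<not> distinct e) + of_bool (common x e = {}))"] pos
    by (simp add: mean_add mean_const mean_cmult stuck_def)
  also have "\<dots> \<le> ?g x"
    using mean_words_not_distinct[OF pos(1), of L] by (intro add_left_mono mult_left_mono add_right_mono) auto
  also have "mean moves (\<lambda>\<omega>. ?F (update \<omega> x) n) \<le> mean moves (\<lambda>\<omega>. \<Sum>m<n. (step ^^ m) ?g (update \<omega> x))"
    by (intro mean_mono Suc.IH update_states Suc.prems)
  also have "\<dots> = (\<Sum>m<n. (step ^^ Suc m) ?g x)"
    unfolding iter_Suc mean_sum ..
  also have "?g x + \<dots> = (\<Sum>m<Suc n. (step ^^ m) ?g x)"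
    by (subst sum.lessThan_Suc_shift) simp
  finally show ?case by simp
qed

text \<open>The bound on \<open>n * L\<close> keeps the expected fraction of missing thieves at
  least \<open>\<delta>\<close> throughout, so the bound on \<open>stuck\<close> applies at every
  time \<open>m < n\<close>.\<close>

lemma mean_pieces_le:
  fixes \<eta> \<delta> :: real
  assumes \<eta>: "n * (1 / t * (1 + (real L)\<^sup>2 / t) ^ n * L)\<^sup>2 \<le> \<eta>\<^sup>2" "\<eta> > 0"
    and \<delta>: "0 < \<delta>" "real n * L \<le> (1 - \<delta>) * B * t"
  shows "mean (words t (n * L)) (\<lambda>w. real (pieces (\<lambda>_. {..<B}) w)) \<le>
    n * (1 + L * ((real L)\<^sup>2 / t + (6 * L / sqrt B + 3 * L * \<eta>) / \<delta> ^ (2 * L)))"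
proof -
  let ?K = "(6 * L / sqrt B + 3 * L * \<eta>) / \<delta> ^ (2 * L)"
  have "ex m stuck \<le> ?K" if "m < n" for m
  proof (rule ex_stuck_le)
    have "m * (1 / t * (1 + (real L)\<^sup>2 / t) ^ m * L)\<^sup>2 \<le> n * (1 / t * (1 + (real L)\<^sup>2 / t) ^ n * L)\<^sup>2"
      using that by (intro mult_mono power_mono power_increasing mult_nonneg_nonneg) auto
    then show "m * (1 / t * (1 + (real L)\<^sup>2 / t) ^ m * L)\<^sup>2 \<le> \<eta>\<^sup>2" using \<eta>(1) by linarith
    have "real m * hit \<le> n * (L / t)"
      using that hit_le hit_nonneg by (intro mult_mono) auto
    also have "\<dots> \<le> (1 - \<delta>) * B"
      using \<delta>(2) pos by (simp add: field_simps)
    finally show "real m * hit \<le> (1 - \<delta>) * B" .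
  qed (use \<eta> \<delta> in auto)
  then have "ex m (\<lambda>y. 1 + L * ((real L)\<^sup>2 / t + stuck y)) \<le> 1 + L * ((real L)\<^sup>2 / t + ?K)" if "m < n" for m
    unfolding ex_add ex_cmult ex_const using that by (intro add_left_mono mult_left_mono) auto
  then have "(\<Sum>m<n. ex m (\<lambda>y. 1 + L * ((real L)\<^sup>2 / t + stuck y))) \<le> (\<Sum>m<n. 1 + L * ((real L)\<^sup>2 / t + ?K))"
    by (intro sum_mono) auto
  then show ?thesis
    using mean_pieces_le_iter[OF initial_state, of n] by (simp add: ex_def)
qed

end


section \<open>Transfer from uniform words to necklaces\<close>

text \<open>
  A uniform word and a necklace can be rearranged to differ in about \<open>t * sqrt k\<close> positions, each of
  which costs at most two cuts. Both distributions are invariant under permutations of the positions,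
  so averaging over these permutations transfers the bound.
\<close>

lemma hamming_Cons: "hamming (a # u) (b # v) = of_bool (a \<noteq> b) + hamming u v"
proof -
  let ?D = "{p. p < length u \<and> u ! p \<noteq> v ! p}"
  have "{p. p < length (a # u) \<and> (a # u) ! p \<noteq> (b # v) ! p} = (if a \<noteq> b then {0} else {}) \<union> Suc ` ?D"
  proof (rule set_eqI)
    fix p
    show "p \<in> {p. p < length (a # u) \<and> (a # u) ! p \<noteq> (b # v) ! p} \<longleftrightarrow>
        p \<in> (if a \<noteq> b then {0} else {}) \<union> Suc ` ?D"
      by (cases p) auto
  qed
  then have "hamming (a # u) (b # v) = card ((if a \<noteq> b then {0} else {}) \<union> Suc ` ?D)"
    by (simp only: hamming_def)
  also have "\<dots> = card (if a \<noteq> b then {0::nat} else {}) + card (Suc ` ?D)"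
    by (rule card_Un_disjoint) auto
  also have "\<dots> = of_bool (a \<noteq> b) + hamming u v"
    by (simp add: card_image hamming_def)
  finally show ?thesis .
qed

text \<open>Greedy choice: copy the letter of \<open>x\<close> while \<open>M\<close> still offers
  it, otherwise spend a letter that \<open>M\<close> has in surplus.\<close>

lemma rearrange_close:
  assumes "size M = length x"
  shows "\<exists>w. mset w = M \<and> hamming w x \<le> size (mset x - M)"
  using assms
proof (induction x arbitrary: M)
  case Nil
  then show ?case by (intro exI[of _ "[]"]) (auto simp: hamming_def)
next
  case (Cons a x)
  show ?case
  proof (cases "a \<in># M")
    case True
    then have "size (M - {#a#}) = length x" using Cons.prems by (simp add: size_Diff_singleton)
    then obtain w where w: "mset w = M - {#a#}" "hamming w x \<le> size (mset x - (M - {#a#}))"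
      using Cons.IH by blast
    have "mset (a # x) - M = mset x - (M - {#a#})"
      using True by (simp add: multiset_eq_iff)
    then show ?thesis using w True by (intro exI[of _ "a # w"]) (auto simp: hamming_Cons)
  next
    case False
    \<comment> \<open>\<open>M\<close> has one element more than \<open>mset x\<close>, so some
      letter is in surplus; spending it leaves \<open>mset x - M\<close> unchanged.\<close>
    have "\<exists>b. count (mset x) b < count M b"
    proof (rule ccontr)
      assume "\<not> ?thesis"
      then have "M \<subseteq># mset x" by (intro mset_subset_eqI) (simp add: not_less)
      then have "size M \<le> size (mset x)" by (rule size_mset_mono)
      then show False using Cons.prems by simp
    qed
    then obtain b where b: "count (mset x) b < count M b" by blast
    then have bM: "b \<in># M" by (metis count_greater_zero_iff less_nat_zero_code neq0_conv)
    then have "size (M - {#b#}) = length x" using Cons.prems by (simp add: size_Diff_singleton)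
    then obtain w where w: "mset w = M - {#b#}" "hamming w x \<le> size (mset x - (M - {#b#}))"
      using Cons.IH by blast
    have "mset x - (M - {#b#}) = mset x - M" using b by (auto simp: multiset_eq_iff)
    moreover have "mset (a # x) - M = add_mset a (mset x - M)"
      using False by (simp add: multiset_eq_iff not_in_iff)
    ultimately show ?thesis using w bM by (intro exI[of _ "b # w"]) (auto simp: hamming_Cons)
  qed
qed

lemma hamming_permute:
  assumes "length u = length v" "p permutes {..<length v}"
  shows "hamming (permute_list p u) (permute_list p v) = hamming u v"
proof -
  have "bij_betw p {q. q < length v \<and> u ! p q \<noteq> v ! p q} {q. q < length v \<and> u ! q \<noteq> v ! q}"
    using permutes_in_image[OF assms(2)] permutes_inj[OF assms(2)] permutes_surj[OF assms(2)]
    by (auto simp: bij_betw_def inj_on_def image_iff inj_def) (metis lessThan_iff surj_def)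
  from bij_betw_same_card[OF this] show ?thesis
  proof -
    assume c: "card {q. q < length v \<and> u ! p q \<noteq> v ! p q} = card {q. q < length v \<and> u ! q \<noteq> v ! q}"
    have "{q. q < length (permute_list p u) \<and> permute_list p u ! q \<noteq> permute_list p v ! q} =
        {q. q < length v \<and> u ! p q \<noteq> v ! p q}"
      using assms by (auto simp: permute_list_nth)
    then show ?thesis using c assms(1) by (simp add: hamming_def)
  qed
qed

section \<open>Averaging over permutations of the positions\<close>

lemma mean_permute_list:
  assumes "\<And>w. w \<in> S \<Longrightarrow> length w = n"
    "\<And>w p. w \<in> S \<Longrightarrow> p permutes {..<n} \<Longrightarrow> permute_list p w \<in> S"
  shows "mean S f = mean S (\<lambda>w. mean {p. p permutes {..<n}} (\<lambda>p. f (permute_list p w)))"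
proof -
  have "mean S f = mean S (\<lambda>w. f (permute_list p w))" if p: "p permutes {..<n}" for p
  proof (rule mean_bij, rule bij_betw_byWitness[where f' = "permute_list (inv p)"])
    have ip: "inv p permutes {..<n}" using p by (rule permutes_inv)
    show "\<forall>w\<in>S. permute_list (inv p) (permute_list p w) = w"
      using assms(1) p ip by (simp add: permute_list_compose[symmetric] permutes_inv_o)
    show "\<forall>w\<in>S. permute_list p (permute_list (inv p) w) = w"
      using assms(1) p ip by (simp add: permute_list_compose[symmetric] permutes_inv_o)
    show "permute_list p ` S \<subseteq> S" "permute_list (inv p) ` S \<subseteq> S"
      using assms(2) p ip by auto
  qed
  then have "mean {p. p permutes {..<n}} (\<lambda>p. mean S (\<lambda>w. f (permute_list p w))) =
      mean {p. p permutes {..<n}} (\<lambda>_. mean S f)"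
    by (intro mean_cong[where A = "{p. p permutes {..<n}}"]) (simp only: mem_Collect_eq)
  then show ?thesis by (subst mean_swap) (simp add: mean_permutations_const)
qed

text \<open>If \<open>s\<close> rearranges \<open>v\<close> into \<open>u\<close>, then composing
  with \<open>s\<close> maps the permutations bijectively to themselves and carries one average to
  the other.\<close>

lemma mean_permutations_mset_eq:
  assumes "mset u = mset v" "length v = n"
  shows "mean {p. p permutes {..<n}} (\<lambda>p. f (permute_list p u)) =
    mean {p. p permutes {..<n}} (\<lambda>p. f (permute_list p v))"
proof -
  obtain s where s: "s permutes {..<n}" "permute_list s v = u"
    using mset_eq_permutation[OF assms(1)] assms(2) by blast
  have "bij_betw ((\<circ>) s) {p. p permutes {..<n}} {p. p permutes {..<n}}"
    by (rule bij_betw_byWitness[where f' = "(\<circ>) (inv s)"])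
      (use s(1) in \<open>auto simp: o_assoc permutes_inv_o intro: permutes_compose permutes_inv\<close>)
  from mean_bij[OF this, of "\<lambda>p. f (permute_list p v)"]
  have "mean {p. p permutes {..<n}} (\<lambda>p. f (permute_list p v)) =
    mean {p. p permutes {..<n}} (\<lambda>p. f (permute_list (s \<circ> p) v))" .
  also have "\<dots> = mean {p. p permutes {..<n}} (\<lambda>p. f (permute_list p u))"
    using s(2) assms(2) by (intro mean_cong) (simp add: permute_list_compose)
  finally show ?thesis ..
qed

text \<open>The word length \<open>m\<close> is separate from the number \<open>k\<close> of
  thieves, so that leftover beads can be treated with no thieves at all.\<close>

definition mean_pieces :: "nat \<Rightarrow> nat \<Rightarrow> nat \<Rightarrow> real" where
  "mean_pieces t k m = mean (words t m) (\<lambda>w. real (pieces (\<lambda>_. {..<k}) w))"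

lemma mean_pieces_necklaces:
  assumes "t > 0" "k > 0"
  shows "mean (necklaces k t 1) (\<lambda>xs. real (pieces (\<lambda>_. {..<k}) xs)) \<le>
    mean_pieces t k (k * t) + 2 * real t * sqrt k"
proof -
  let ?n = "k * t"
  let ?P = "{p. p permutes {..<?n}}"
  let ?N = "necklaces k t 1"
  let ?f = "\<lambda>w. real (pieces (\<lambda>_. {..<k}) w)"
  let ?dev = "\<lambda>w. \<Sum>i<t. \<bar>real (count_list w i) - k\<bar>"
  have set_perm: "set (permute_list p w) = set w" if "p permutes {..<length w}" for p and w :: "nat list"
    using mset_permute_list[OF that] by (rule mset_eq_setD)
  have words: "mean (words t ?n) ?f = mean (words t ?n) (\<lambda>w. mean ?P (\<lambda>p. ?f (permute_list p w)))"
    by (rule mean_permute_list) (auto simp: words_def set_perm)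
  have neck: "mean ?N ?f = mean ?N (\<lambda>w. mean ?P (\<lambda>p. ?f (permute_list p w)))"
    by (rule mean_permute_list) (auto simp: necklaces_def set_perm count_mset[symmetric] mset_permute_list)
  \<comment> \<open>Replace \<open>w\<close> by a rearrangement \<open>v\<close> close to
    \<open>x\<close>: the average over permutations is unchanged, and a common permutation preserves
    the Hamming distance.\<close>
  have step: "mean ?P (\<lambda>p. ?f (permute_list p x)) \<le> mean ?P (\<lambda>p. ?f (permute_list p w)) + 2 * ?dev w"
    if x: "x \<in> ?N" and w: "w \<in> words t ?n" for x w
  proof -
    have lx: "length x = ?n" and lw: "length w = ?n" using x w by (auto simp: necklaces_def words_def)
    obtain v where v: "mset v = mset w" "hamming v x \<le> size (mset x - mset w)"
      using rearrange_close[of "mset w" x] lx lw by auto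
    have lv: "length v = ?n" using v(1) lw by (metis size_mset)
    have "real (hamming v x) \<le> ?dev w"
    proof -
      have sub: "set_mset (mset x - mset w) \<subseteq> {..<t}"
      proof
        fix i assume "i \<in># mset x - mset w"
        then have "i \<in># mset x" by (rule in_diffD)
        then show "i \<in> {..<t}" using x by (auto simp: necklaces_def)
      qed
      have "real (hamming v x) \<le> real (size (mset x - mset w))" using v(2) by simp
      also have "size (mset x - mset w) = (\<Sum>i\<in>set_mset (mset x - mset w). count (mset x - mset w) i)"
        by (simp add: size_multiset_overloaded_eq)
      also have "\<dots> = (\<Sum>i<t. count (mset x - mset w) i)"
        using sub by (intro sum.mono_neutral_left) (auto simp: not_in_iff)
      also have "real \<dots> \<le> ?dev w"
        unfolding of_nat_sum
      proof (rule sum_mono)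
        fix i assume "i \<in> {..<t}"
        then have "count_list x i = k" using x by (simp add: necklaces_def)
        then show "real (count (mset x - mset w) i) \<le> \<bar>real (count_list w i) - k\<bar>"
          by (simp add: count_mset)
      qed
      finally show ?thesis .
    qed
    then have "mean ?P (\<lambda>p. ?f (permute_list p x)) \<le> mean ?P (\<lambda>p. ?f (permute_list p v) + 2 * ?dev w)"
    proof (intro mean_mono)
      fix p assume "p \<in> ?P" and d: "real (hamming v x) \<le> ?dev w"
      then have p: "p permutes {..<?n}" by simp
      have "pieces (\<lambda>_. {..<k}) (permute_list p x) \<le>
          pieces (\<lambda>_. {..<k}) (permute_list p v) + 2 * hamming (permute_list p x) (permute_list p v)"
        using lx lv by (intro pieces_hamming) simp
      also have "hamming (permute_list p x) (permute_list p v) = hamming x v"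
        using lx lv p by (intro hamming_permute) auto
      also have "hamming x v = hamming v x"
        using lx lv by (auto simp: hamming_def intro: arg_cong[where f = card])
      finally show "?f (permute_list p x) \<le> ?f (permute_list p v) + 2 * ?dev w"
        using d by linarith
    qed
    also have "\<dots> = mean ?P (\<lambda>p. ?f (permute_list p w)) + 2 * ?dev w"
      using mean_permutations_mset_eq[OF v(1) lw, of ?f] by (simp add: mean_add mean_permutations_const)
    finally show ?thesis .
  qed
  \<comment> \<open>Each of the \<open>t\<close> counts has variance at most \<open>k\<close>, hence
    mean absolute deviation at most \<open>sqrt k\<close>.\<close>
  have "mean (words t ?n) ?dev \<le> t * sqrt k"
  proof -
    have "mean (words t ?n) (\<lambda>w. \<bar>real (count_list w i) - k\<bar>) \<le> sqrt k" if "i < t" for i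
    proof -
      have r: "sqrt k > 0" using assms by simp
      have "mean (words t ?n) (\<lambda>w. (real (count_list w i) - k)\<^sup>2) \<le> k"
        using mean_count_list_square[OF assms(1) that, of ?n k] assms by simp
      then have "1 / (2 * sqrt k) * mean (words t ?n) (\<lambda>w. (real (count_list w i) - k)\<^sup>2) \<le> 1 / (2 * sqrt k) * k"
        using r by (intro mult_left_mono) auto
      also have "\<dots> = sqrt k / 2" using r real_sqrt_mult_self[of k] by (simp add: field_simps)
      finally have "1 / (2 * sqrt k) * mean (words t ?n) (\<lambda>w. (real (count_list w i) - k)\<^sup>2) + sqrt k / 2 \<le> sqrt k"
        by simp
      moreover have "mean (words t ?n) (\<lambda>w. \<bar>real (count_list w i) - k\<bar>) \<le>
          mean (words t ?n) (\<lambda>w. 1 / (2 * sqrt k) * (real (count_list w i) - k)\<^sup>2 + sqrt k / 2)"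
        by (intro mean_mono abs_le_am_gm r)
      ultimately show ?thesis using assms unfolding mean_add mean_cmult by (simp add: mean_const)
    qed
    then have "(\<Sum>i<t. mean (words t ?n) (\<lambda>w. \<bar>real (count_list w i) - k\<bar>)) \<le> (\<Sum>i<t. sqrt k)"
      by (intro sum_mono) auto
    then show ?thesis by (simp add: mean_sum)
  qed
  \<comment> \<open>The comparison holds for every \<open>w\<close>, so it may be averaged over all
    words while \<open>x\<close> stays fixed.\<close>
  moreover have "mean ?P (\<lambda>p. ?f (permute_list p x)) \<le> mean (words t ?n) ?f + 2 * mean (words t ?n) ?dev"
    if "x \<in> ?N" for x
  proof -
    have "mean ?P (\<lambda>p. ?f (permute_list p x)) = mean (words t ?n) (\<lambda>_. mean ?P (\<lambda>p. ?f (permute_list p x)))"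
      using assms by (simp add: mean_const)
    also have "\<dots> \<le> mean (words t ?n) (\<lambda>w. mean ?P (\<lambda>p. ?f (permute_list p w)) + 2 * ?dev w)"
      using that by (intro mean_mono step)
    also have "\<dots> = mean (words t ?n) ?f + 2 * mean (words t ?n) ?dev"
      unfolding words mean_add mean_cmult ..
    finally show ?thesis .
  qed
  ultimately have "mean ?P (\<lambda>p. ?f (permute_list p x)) \<le> mean (words t ?n) ?f + 2 * (t * sqrt k)"
    if "x \<in> ?N" for x using that by fastforce
  then have "mean ?N ?f \<le> mean ?N (\<lambda>_. mean (words t ?n) ?f + 2 * (t * sqrt k))"
    unfolding neck by (intro mean_mono)
  then show ?thesis
    by (simp add: mean_const finite_necklaces necklaces_nonempty mean_pieces_def)
qed

section \<open>Many thieves\<close>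

text \<open>Two disjoint blocks of thieves serve the two parts of the word.\<close>

lemma mean_pieces_add:
  assumes "t > 0"
  shows "mean_pieces t (k + l) (m + n) \<le> mean_pieces t k m + mean_pieces t l n"
proof -
  have "pieces (\<lambda>_. {..<k + l}) (u @ v) \<le> pieces (\<lambda>_. {..<k}) u + pieces (\<lambda>_. {..<l}) v" for u v
  proof -
    have "pieces (\<lambda>_. {..<k + l}) (u @ v) \<le> pieces (\<lambda>_. {..<k}) u + pieces (\<lambda>_. {k..<k + l}) v"
      by (rule pieces_append) auto
    also have "pieces (\<lambda>_. {k..<k + l}) v \<le> pieces (\<lambda>_. {..<l}) v"
      by (rule pieces_rename[of "\<lambda>c. k + c"]) auto
    finally show ?thesis by simp
  qed
  then have "mean_pieces t (k + l) (m + n) \<le> mean (words t m) (\<lambda>u. mean (words t n) (\<lambda>v.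
      real (pieces (\<lambda>_. {..<k}) u) + real (pieces (\<lambda>_. {..<l}) v)))"
    unfolding mean_pieces_def mean_words_append by (intro mean_mono) (metis of_nat_add of_nat_mono)
  then show ?thesis using assms by (simp add: mean_add mean_const mean_pieces_def)
qed

lemma mean_pieces_le_length:
  assumes "t > 0"
  shows "mean_pieces t k m \<le> m"
proof -
  have "mean_pieces t k m \<le> mean (words t m) (\<lambda>_. m)"
    unfolding mean_pieces_def
  proof (intro mean_mono)
    fix w assume "w \<in> words t m"
    then show "real (pieces (\<lambda>_. {..<k}) w) \<le> real m"
      using pieces_le_length[of _ w] by (simp add: words_def)
  qed
  then show ?thesis using assms by (simp add: mean_const)
qed

lemma mean_pieces_mult:
  assumes "t > 0"
  shows "mean_pieces t (g * k) (g * m) \<le> g * mean_pieces t k m"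
proof (induction g)
  case 0
  then show ?case using mean_pieces_le_length[OF assms, of 0 0] by simp
next
  case (Suc g)
  then show ?case using mean_pieces_add[OF assms, of k "g * k" m "g * m"] by (simp add: algebra_simps)
qed

text \<open>The four shares of \<open>\<delta>\<close> are: one piece per interval, failed
  intervals, the unprocessed end of the stretch, and rounding.\<close>

lemma mean_pieces_group:
  fixes \<delta> :: real
  assumes \<delta>: "0 < \<delta>" "\<delta> \<le> 1"
  shows "\<exists>B>0. \<exists>T. \<forall>t::nat. real t \<ge> T \<longrightarrow> mean_pieces t B (B * t) \<le> 4 * \<delta> * B * t"
proof -
  \<comment> \<open>Long enough that one piece per interval amounts to at most a fraction
    \<open>\<delta>\<close> of the beads.\<close>
  define L where "L = nat \<lceil>1 / \<delta>\<rceil>"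
  have L': "1 / \<delta> \<le> real L" unfolding L_def by linarith
  moreover have "1 / \<delta> > 0" using \<delta> by simp
  ultimately have "real L > 0" by linarith
  then have L: "1 / real L \<le> \<delta>" "L > 0"
    using L' \<delta> by (auto simp: field_simps)
  \<comment> \<open>With \<open>sqrt B \<ge> b\<close>, and with \<open>\<eta>\<close> below, each
    of the two errors in the bound on \<open>stuck\<close> is at most
    \<open>\<delta> / 3\<close>.\<close>
  define b where "b = 18 * L / \<delta> ^ (2 * L + 1)"
  define B where "B = nat \<lceil>b\<^sup>2\<rceil> + 1"
  have b: "b > 0" using \<delta> L by (simp add: b_def)
  have B: "B > 0" by (simp add: B_def)
  have "b\<^sup>2 \<le> B" unfolding B_def by linarith
  then have sqrtB: "b \<le> sqrt B" using b real_le_rsqrt by blast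
  define \<eta> where "\<eta> = \<delta> ^ (2 * L + 1) / (9 * L)"
  have \<eta>: "\<eta> > 0" using \<delta> L by (simp add: \<eta>_def)
  \<comment> \<open>The summands ensure in turn that \<open>t\<close> is positive, that repeated
    types contribute at most \<open>\<delta> / 3\<close>, that \<open>L \<le> \<delta> * t\<close>,
    and that the variance bound is at most \<open>\<eta>\<^sup>2\<close>.\<close>
  define T where "T = 1 + 3 * (real L)\<^sup>2 / \<delta> + L / \<delta> + B * (exp (B * L) * L)\<^sup>2 / \<eta>\<^sup>2"
  have "mean_pieces t B (B * t) \<le> 4 * \<delta> * B * t" if tT: "real t \<ge> T" for t
  proof -
    have nn: "0 \<le> 3 * (real L)\<^sup>2 / \<delta>" "0 \<le> L / \<delta>" "0 \<le> B * (exp (B * L) * L)\<^sup>2 / \<eta>\<^sup>2"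
      using \<delta> by auto
    have t: "real t \<ge> 1" "3 * (real L)\<^sup>2 / \<delta> \<le> t" "L / \<delta> \<le> t" "B * (exp (B * L) * L)\<^sup>2 / \<eta>\<^sup>2 \<le> t"
      using tT nn unfolding T_def by linarith+
    have t0: "t > 0" using t(1) by (cases t) auto
    interpret assignment_process t B L by standard (use t0 B L in auto)
    \<comment> \<open>Process intervals until about a fraction \<open>\<delta>\<close> of the
      \<open>B * t\<close> beads is left.\<close>
    define n where "n = nat \<lfloor>(1 - \<delta>) * B * t / L\<rfloor>"
    have "0 \<le> (1 - \<delta>) * B * t / L" using \<delta> by simp
    then have "real n \<le> (1 - \<delta>) * B * t / L" "(1 - \<delta>) * B * t / L \<le> n + 1"
      unfolding n_def by linarith+
    then have n: "real n * L \<le> (1 - \<delta>) * B * t" "(1 - \<delta>) * B * t \<le> real n * L + L"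
      using L(2) by (auto simp: field_simps)
    have nBt: "real n * L \<le> B * t"
    proof -
      have "(1 - \<delta>) * (B * t) \<le> 1 * real (B * t)" using \<delta> by (intro mult_right_mono) auto
      then show ?thesis using n(1) by simp
    qed
    have cond: "n * (1 / t * (1 + (real L)\<^sup>2 / t) ^ n * L)\<^sup>2 \<le> \<eta>\<^sup>2"
    proof -
      \<comment> \<open>As \<open>n * L \<le> B * t\<close>, the Lipschitz constants grow in total
        by at most \<open>exp (B * L)\<close>, which does not depend on \<open>t\<close>.\<close>
      have "(1 + (real L)\<^sup>2 / t) ^ n \<le> exp ((real L)\<^sup>2 / t) ^ n"
        by (intro power_mono) auto
      also have "\<dots> = exp (n * ((real L)\<^sup>2 / t))" by (rule exp_of_nat_mult[symmetric])
      also have "n * ((real L)\<^sup>2 / t) = real n * L * (L / t)" by (simp add: power2_eq_square)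
      also have "\<dots> \<le> B * t * (L / t)" using nBt by (intro mult_right_mono) auto
      also have "\<dots> = B * L" using t0 by simp
      finally have e: "(1 + (real L)\<^sup>2 / t) ^ n \<le> exp (B * L)" by simp
      have "real n * 1 \<le> real n * L" using L(2) by (intro mult_left_mono) auto
      then have n': "real n \<le> B * t" using nBt by linarith
      have "n * (1 / t * (1 + (real L)\<^sup>2 / t) ^ n * L)\<^sup>2 \<le> B * t * (1 / t * exp (B * L) * L)\<^sup>2"
        using e n' by (intro mult_mono power_mono mult_nonneg_nonneg) auto
      also have "\<dots> = B * (exp (B * L) * L)\<^sup>2 / t"
        using t0 by (simp add: power2_eq_square field_simps)
      also have "\<dots> \<le> \<eta>\<^sup>2"
        using t(4) \<eta> t0 by (simp add: field_simps)
      finally show ?thesis .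
    qed
    let ?bad = "(real L)\<^sup>2 / t + (6 * L / sqrt B + 3 * L * \<eta>) / \<delta> ^ (2 * L)"
    have bad: "?bad \<le> \<delta>"
    proof -
      have 1: "(real L)\<^sup>2 / t \<le> \<delta> / 3" using t(2) \<delta> t0 by (simp add: field_simps)
      have "6 * L / sqrt B \<le> 6 * L / b" using sqrtB b B by (intro divide_left_mono mult_pos_pos) auto
      also have "\<dots> = \<delta> ^ (2 * L) * (\<delta> / 3)" using L(2) \<delta> by (simp add: b_def)
      finally have 2: "6 * L / sqrt B \<le> \<delta> ^ (2 * L) * (\<delta> / 3)" .
      have 3: "3 * L * \<eta> = \<delta> ^ (2 * L) * (\<delta> / 3)" using L(2) by (simp add: \<eta>_def)
      have "(6 * L / sqrt B + 3 * L * \<eta>) / \<delta> ^ (2 * L) \<le>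
          (\<delta> ^ (2 * L) * (\<delta> / 3) + \<delta> ^ (2 * L) * (\<delta> / 3)) / \<delta> ^ (2 * L)"
        using \<delta> unfolding 3 by (intro divide_right_mono add_right_mono 2) auto
      also have "\<dots> = 2 * \<delta> / 3" using \<delta> by (simp add: add_divide_distrib)
      finally show ?thesis using 1 by linarith
    qed
    have "mean_pieces t B (n * L) \<le> n * (1 + L * ?bad)"
      unfolding mean_pieces_def using cond \<eta> \<delta>(1) n(1) by (rule mean_pieces_le)
    also have "\<dots> \<le> n * (1 + L * \<delta>)" using bad by (intro mult_left_mono add_left_mono) auto
    also have "\<dots> = real n * L * (1 / L + \<delta>)" using L(2) by (simp add: field_simps)
    also have "\<dots> \<le> B * t * (\<delta> + \<delta>)" using nBt L \<delta> by (intro mult_mono) auto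
    finally have 1: "mean_pieces t B (n * L) \<le> 2 * \<delta> * B * t" by (simp add: mult_ac)
    have le: "n * L \<le> B * t" using nBt by (metis of_nat_le_iff of_nat_mult)
    have "mean_pieces t B (B * t) \<le> mean_pieces t B (n * L) + mean_pieces t 0 (B * t - n * L)"
      using mean_pieces_add[OF t0, of B 0 "n * L" "B * t - n * L"] le by simp
    also have "mean_pieces t 0 (B * t - n * L) \<le> real (B * t - n * L)"
      by (rule mean_pieces_le_length[OF t0])
    also have "real (B * t - n * L) = B * t - real n * L" using le by (simp add: of_nat_diff)
    also have "\<dots> \<le> \<delta> * B * t + L" using n(2) by (simp add: algebra_simps)
    also have "real L \<le> \<delta> * B * t"
    proof -
      have "real L \<le> \<delta> * t * 1" using t(3) \<delta> by (simp add: field_simps)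
      also have "\<dots> \<le> \<delta> * t * B" using B \<delta> by (intro mult_left_mono) auto
      finally show ?thesis by (simp add: mult_ac)
    qed
    finally show ?thesis using 1 by linarith
  qed
  then show ?thesis using B by blast
qed

text \<open>Split the thieves into groups of size \<open>B\<close>. The remaining fewer than
  \<open>B\<close> thieves get a stretch cut into single beads, which costs at most
  \<open>\<delta> * k * t\<close> once \<open>k \<ge> B / \<delta>\<close>.\<close>

lemma mean_pieces_small:
  fixes \<delta> :: real
  assumes \<delta>: "0 < \<delta>" "\<delta> \<le> 1"
  shows "\<exists>T. \<forall>t k :: nat. real t \<ge> T \<longrightarrow> real k \<ge> T \<longrightarrow> mean_pieces t k (k * t) \<le> 5 * \<delta> * k * t"
proof -
  obtain B T where B: "B > 0" and T: "\<And>t. real t \<ge> T \<Longrightarrow> mean_pieces t B (B * t) \<le> 4 * \<delta> * B * t"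
    using mean_pieces_group[OF \<delta>] by blast
  have "mean_pieces t k (k * t) \<le> 5 * \<delta> * k * t"
    if tk: "real t \<ge> max 1 (max T (B / \<delta>))" "real k \<ge> max 1 (max T (B / \<delta>))" for t k
  proof -
    have t0: "t > 0" using tk by (cases t) auto
    define g r where "g = k div B" and "r = k mod B"
    have k: "k = g * B + r" by (simp add: g_def r_def)
    have r: "r \<le> B" using B by (simp add: r_def less_imp_le)
    have "mean_pieces t k (k * t) \<le> mean_pieces t (g * B) (g * (B * t)) + mean_pieces t r (r * t)"
      using mean_pieces_add[OF t0, of "g * B" r "g * (B * t)" "r * t"] by (simp add: k algebra_simps)
    also have "mean_pieces t (g * B) (g * (B * t)) \<le> g * mean_pieces t B (B * t)"
      by (rule mean_pieces_mult[OF t0])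
    also have "g * mean_pieces t B (B * t) \<le> g * (4 * \<delta> * B * t)"
      using T[of t] tk by (intro mult_left_mono) auto
    also have "\<dots> = 4 * \<delta> * t * real (g * B)" by simp
    also have "\<dots> \<le> 4 * \<delta> * t * k" using \<delta> by (intro mult_left_mono) (auto simp: k)
    also have "mean_pieces t r (r * t) \<le> real r * t"
      using mean_pieces_le_length[OF t0, of r "r * t"] by simp
    also have "\<dots> \<le> \<delta> * k * t"
    proof (intro mult_right_mono)
      have "real B \<le> \<delta> * k" using tk(2) \<delta> by (simp add: field_simps)
      then show "real r \<le> \<delta> * k" using r by linarith
    qed simp
    finally show ?thesis by (simp add: algebra_simps)
  qed
  then show ?thesis by blast
qed

section \<open>From the mean to a bound in probability\<close>

theorem theorem1p3:
  fixes \<epsilon> :: real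
  assumes "\<epsilon> > 0"
  shows "\<exists>T::real. \<forall>t k :: nat.
           t \<ge> 1 \<and> k \<ge> 1 \<and> real t \<ge> T \<and> real k \<ge> T * ln (real t) \<longrightarrow>
           measure_pmf.prob (random_necklace k t 1)
             {xs. real (min_fair_cuts k t 1 xs) \<le> \<epsilon> * real k * real t} \<ge> 1 - \<epsilon>"
proof -
  \<comment> \<open>Uniform words cost \<open>5 * \<delta>\<close> and the transfer
    \<open>2 * \<delta>\<close>, relative to \<open>k * t\<close>. A mean of at most
    \<open>\<epsilon>\<^sup>2 * k * t\<close> leaves failure probability \<open>\<epsilon>\<close>
    at the level \<open>\<epsilon> * k * t\<close>.\<close>
  define \<delta> where "\<delta> = min 1 (\<epsilon>\<^sup>2 / 7)"
  have \<delta>: "0 < \<delta>" "\<delta> \<le> 1" "7 * \<delta> \<le> \<epsilon>\<^sup>2" using assms by (auto simp: \<delta>_def)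
  obtain T where T: "\<And>t k :: nat. real t \<ge> T \<Longrightarrow> real k \<ge> T \<Longrightarrow> mean_pieces t k (k * t) \<le> 5 * \<delta> * k * t"
    using mean_pieces_small[OF \<delta>(1,2)] by blast
  \<comment> \<open>The 3 gives \<open>ln t \<ge> 1\<close>, so that \<open>k \<ge> T'\<close> as
    well; the last term gives \<open>sqrt k \<le> \<delta> * k\<close>.\<close>
  define T' where "T' = max 3 (max T (1 / \<delta>\<^sup>2))"
  have "measure_pmf.prob (random_necklace k t 1)
      {xs. real (min_fair_cuts k t 1 xs) \<le> \<epsilon> * real k * real t} \<ge> 1 - \<epsilon>"
    if tk: "t \<ge> 1" "k \<ge> 1" "real t \<ge> T'" "real k \<ge> T' * ln (real t)" for t k :: nat
  proof -
    have "exp 1 \<le> real t" using tk(3) exp_le by (simp add: T'_def)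
    then have "ln (real t) \<ge> 1" using tk(1) by (subst ln_ge_iff) auto
    moreover have "T' \<ge> 0" by (simp add: T'_def)
    ultimately have "T' * 1 \<le> T' * ln (real t)" by (intro mult_left_mono)
    then have k: "real k \<ge> T'" using tk(4) by linarith
    let ?N = "necklaces k t 1"
    let ?X = "\<lambda>xs. real (min_fair_cuts k t 1 xs)"
    let ?S = "{xs. ?X xs \<le> \<epsilon> * k * t}"
    have fin: "finite ?N" "?N \<noteq> {}" by (rule finite_necklaces necklaces_nonempty)+
    have kt: "real k * t > 0" using tk by simp
    have "mean ?N ?X \<le> mean ?N (\<lambda>xs. real (pieces (\<lambda>_. {..<k}) xs))"
      using min_fair_cuts_le_pieces by (intro mean_mono) auto
    also have "\<dots> \<le> mean_pieces t k (k * t) + 2 * real t * sqrt k"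
      using tk by (intro mean_pieces_necklaces) auto
    also have "mean_pieces t k (k * t) \<le> 5 * \<delta> * k * t"
      using T tk(3) k by (simp add: T'_def)
    also have "2 * real t * sqrt k \<le> 2 * real t * (\<delta> * k)"
    proof -
      have "1 / \<delta> \<le> sqrt k"
        using k \<delta>(1) by (intro real_le_rsqrt) (simp add: T'_def power_divide)
      then have "1 \<le> \<delta> * sqrt k" using \<delta>(1) by (simp add: field_simps)
      then have "1 * sqrt k \<le> \<delta> * sqrt k * sqrt k" by (intro mult_right_mono) auto
      also have "\<dots> = \<delta> * k" by simp
      finally show ?thesis by (intro mult_left_mono) auto
    qed
    finally have "mean ?N ?X \<le> 7 * \<delta> * (k * t)" by (simp add: algebra_simps)
    also have "\<dots> \<le> \<epsilon>\<^sup>2 * (k * t)" using \<delta>(3) by (intro mult_right_mono) auto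
    finally have "mean ?N ?X \<le> \<epsilon>\<^sup>2 * (k * t)" .
    \<comment> \<open>Markov's inequality.\<close>
    moreover have "\<epsilon> * k * t * mean ?N (\<lambda>xs. of_bool (xs \<notin> ?S)) \<le> mean ?N ?X"
      unfolding mean_cmult[symmetric] using assms by (intro mean_mono) (auto simp: of_bool_def)
    ultimately have "(\<epsilon> * (k * t)) * mean ?N (\<lambda>xs. of_bool (xs \<notin> ?S)) \<le> (\<epsilon> * (k * t)) * \<epsilon>"
      by (simp add: power2_eq_square mult_ac)
    then have bad: "mean ?N (\<lambda>xs. of_bool (xs \<notin> ?S)) \<le> \<epsilon>"
      using assms kt by (subst (asm) mult_le_cancel_left_pos) auto
    have "measure_pmf.prob (random_necklace k t 1) ?S = card (?N \<inter> ?S) / card ?N"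
      unfolding random_necklace_def using fin by (intro measure_pmf_of_set)
    also have "\<dots> = mean ?N (\<lambda>xs. of_bool (xs \<in> ?S))"
      using fin by (simp add: mean_def of_bool_def sum.If_cases)
    also have "\<dots> = mean ?N (\<lambda>xs. 1 - of_bool (xs \<notin> ?S))" by (intro mean_cong) auto
    also have "\<dots> = 1 - mean ?N (\<lambda>xs. of_bool (xs \<notin> ?S))"
      unfolding mean_diff mean_const[OF fin] ..
    finally show ?thesis using bad by simp
  qed
  then show ?thesis by blast
qed

end
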